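(* Suppose $X$ and $Y$ are normal spaces and there is a linear continuous surjection $T:D_p(X)\to D_p(Y)$. If $X$ is strongly countable-dimensional, then so is $Y$.
   Context: All spaces are Tychonoff (normal spaces are assumed Hausdorff). For a space $X$, $C(X)$ is the linear space of all continuous real-valued functions on $X$ and $C^*(X)$ is its subspace of bounded functions. $D(X)$ denotes either $C(X)$ or $C^*(X)$, and $D(Y)$ denotes either $C(Y)$ or $C^*(Y)$; the two choices are independent. $D_p(X)$ is $D(X)$ endowed with the topology of pointwise convergence. A normal space is strongly countable-dimensional if it is the union of countably many closed subspaces each of finite covering dimension $\dim$. Here $\dim X\leq n$ means that every finite functionally open (cozero) cover of $X$ has a finite functionally open refinement of order $\leq n$ (every point lies in at most $n+1$ members). *)

theory Defs
  imports "HOL-Analysis.Analysis"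
begin

text \<open>Functions on a space are made extensional, i.e. equal to \<^const>\<open>undefined\<close> off the
  carrier, so that equality in a function space is equality of functions on the carrier.\<close>

definition cont_funs :: "'a topology \<Rightarrow> ('a \<Rightarrow> real) set" where
  "cont_funs X = {f \<in> extensional (topspace X). continuous_map X euclideanreal f}"

definition bdd_cont_funs :: "'a topology \<Rightarrow> ('a \<Rightarrow> real) set" where
  "bdd_cont_funs X = {f \<in> cont_funs X. bounded (f ` topspace X)}"

definition pointwise_topology :: "'a topology \<Rightarrow> ('a \<Rightarrow> real) set \<Rightarrow> ('a \<Rightarrow> real) topology" where
  "pointwise_topology X D = subtopology (powertop_real (topspace X)) D"

text \<open>The sum and the scalar multiples are restricted to the carrier since extensional functions
  are not closed under the operations on total functions.\<close>

definition linear_operator_on ::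
  "'a topology \<Rightarrow> 'b topology \<Rightarrow> ('a \<Rightarrow> real) set \<Rightarrow> (('a \<Rightarrow> real) \<Rightarrow> 'b \<Rightarrow> real) \<Rightarrow> bool" where
  "linear_operator_on X Y D T \<longleftrightarrow>
     (\<forall>f\<in>D. \<forall>g\<in>D. T (\<lambda>x\<in>topspace X. f x + g x) = (\<lambda>y\<in>topspace Y. T f y + T g y)) \<and>
     (\<forall>c. \<forall>f\<in>D. T (\<lambda>x\<in>topspace X. c * f x) = (\<lambda>y\<in>topspace Y. c * T f y))"

definition cozero_in :: "'a topology \<Rightarrow> 'a set \<Rightarrow> bool" where
  "cozero_in X U \<longleftrightarrow>
     (\<exists>f. continuous_map X euclideanreal f \<and> U = {x \<in> topspace X. f x \<noteq> 0})"

definition finite_cozero_cover :: "'a topology \<Rightarrow> 'a set set \<Rightarrow> bool" where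
  "finite_cozero_cover X \<U> \<longleftrightarrow>
     finite \<U> \<and> (\<forall>U\<in>\<U>. cozero_in X U) \<and> \<Union>\<U> = topspace X"

text \<open>Covering dimension in the functionally open sense; it is different from the inductive
  dimension \<^const>\<open>dimension_le\<close>.\<close>

definition covering_dim_le :: "'a topology \<Rightarrow> nat \<Rightarrow> bool" where
  "covering_dim_le X n \<longleftrightarrow>
     (\<forall>\<U>. finite_cozero_cover X \<U> \<longrightarrow>
       (\<exists>\<V>. finite_cozero_cover X \<V> \<and>
            (\<forall>V\<in>\<V>. \<exists>U\<in>\<U>. V \<subseteq> U) \<and>
            (\<forall>x\<in>topspace X. card {V \<in> \<V>. x \<in> V} \<le> n + 1)))"

text \<open>This notion is meant for normal Hausdorff spaces; normality is not part of the predicate.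
  There need not be a common bound on the dimensions of the members.\<close>

definition strongly_countable_dimensional :: "'a topology \<Rightarrow> bool" where
  "strongly_countable_dimensional X \<longleftrightarrow>
     (\<exists>\<F>. countable \<F> \<and> \<Union>\<F> = topspace X \<and>
          (\<forall>F\<in>\<F>. closedin X F \<and> (\<exists>n. covering_dim_le (subtopology X F) n)))"

lemma topspace_pointwise_topology:
  assumes "D \<subseteq> cont_funs X"
  shows "topspace (pointwise_topology X D) = D"
  using assms by (auto simp: pointwise_topology_def cont_funs_def PiE_def)

end

theory Submission
  imports Defs
begin

text \<open>Evaluation of \<open>T f\<close> at \<open>y\<close> is a finite combination \<open>\<mu>\<^sub>y = \<Sum> \<mu> x * f x\<close>. The space
  \<open>Y\<close> is the union of countably many closed pieces on which the support of \<open>\<mu>\<^sub>y\<close> lies in a finite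
  union \<open>K\<close> of finite-dimensional closed sets and has at most \<open>q\<close> points, and the norm of \<open>\<mu>\<^sub>y\<close> is
  at most \<open>p\<close>. A cover of a piece may be taken to consist of the cozero sets of functions
  \<open>T (f j)\<close>. On \<open>K\<close> there is a partition of unity \<open>\<phi>\<close> of bounded order on whose members each
  \<open>f j\<close> is nearly constant. Each \<open>y\<close> of the piece then has a bounded number \<open>R\<close> of nonzero
  coefficients \<open>\<mu>\<^sub>y (\<phi> V)\<close>, and these nearly determine \<open>T (f j) y\<close>. By a quantitative
  version of the injectivity of the moment curve, \<open>R\<close> functions \<open>T (h m)\<close> with
  \<open>h m = (\<Sum>V. c V ^ m * \<phi> V)\<close> control all the coefficients. Hence the cover is refined by preimages
  of small cubes under a map into a Euclidean space whose dimension does not depend on the cover.\<close>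

text \<open>The open sets where \<open>\<rho>\<close> is below \<open>b\<close> exhaust the space,
  and on each of them \<open>h\<close> is one continuous function, so pasting applies. This gives
  continuity of sums over infinite index sets of which only finitely many terms survive where
  \<open>\<rho>\<close> is bounded.\<close>

lemma continuous_map_local_agreement:
  fixes \<rho> h :: "'a \<Rightarrow> real"
  assumes \<rho>: "continuous_map X euclideanreal \<rho>"
    and H: "\<And>b::nat. continuous_map X euclideanreal (H b)"
    and eq: "\<And>x b. x \<in> topspace X \<Longrightarrow> \<rho> x < real b \<Longrightarrow> h x = H b x"
  shows "continuous_map X euclideanreal h"
proof (rule pasting_lemma[where I = UNIV and T = "\<lambda>b. {x \<in> topspace X. \<rho> x < real b}" and f = H])
  fix b :: nat
  have "{x \<in> topspace X. \<rho> x < real b} = {x \<in> topspace X. \<rho> x \<in> {..<real b}}" by auto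
  then show "openin X {x \<in> topspace X. \<rho> x < real b}"
    using openin_continuous_map_preimage[OF \<rho>, of "{..<real b}"] by auto
  show "continuous_map (subtopology X {x \<in> topspace X. \<rho> x < real b}) euclideanreal (H b)"
    using H by (rule continuous_map_from_subtopology)
next
  fix x assume "x \<in> topspace X"
  then show "\<exists>j. j \<in> UNIV \<and> x \<in> {x \<in> topspace X. \<rho> x < real j} \<and> h x = H j x"
    using eq reals_Archimedean2[of "\<rho> x"] by blast
qed (use eq in \<open>metis (mono_tags, lifting) Int_iff mem_Collect_eq\<close>)

section \<open>Sparse nodes and power sums\<close>

text \<open>Along an enumeration of \<open>I\<close> each value is chosen above its lower bound and
  above twice the preceding value plus one. The separation carries \<open>1 + c w\<close> because
  this is exactly what eliminating the node \<open>w\<close> costs in the power sums below.\<close>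

lemma sparse_sequence:
  fixes b :: "'v \<Rightarrow> real"
  assumes "countable I"
  shows "\<exists>c :: 'v \<Rightarrow> real. (\<forall>v\<in>I. 0 < c v \<and> b v \<le> c v) \<and>
    (\<forall>v\<in>I. \<forall>w\<in>I. v \<noteq> w \<longrightarrow> 1 + c w \<le> 2 * \<bar>c v - c w\<bar>)"
proof -
  \<comment> \<open>\<open>from_nat_into\<close> is total, so for a finite \<open>I\<close> the
    recursion simply runs past the end. The maximum with 1 makes all nodes positive.\<close>
  define B where "B n = max 1 (b (from_nat_into I n))" for n
  define s where "s = rec_nat (B 0) (\<lambda>n r. max (B (Suc n)) (2 * r + 1))"
  have s0: "s 0 = B 0" and sS: "s (Suc n) = max (B (Suc n)) (2 * s n + 1)" for n
    by (auto simp: s_def)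
  have sB: "B n \<le> s n" for n by (cases n) (auto simp: s0 sS)
  have s1: "1 \<le> s n" for n using sB[of n] by (auto simp: B_def)
  have sm: "m < n \<Longrightarrow> 2 * s m + 1 \<le> s n" for m n
  proof (induction n)
    case (Suc n)
    then have "m = n \<or> 2 * s m + 1 \<le> s n" using less_SucE by blast
    then show ?case using s1[of n] by (auto simp: sS)
  qed auto
  define c where "c v = s (to_nat_on I v)" for v
  show ?thesis
  proof (intro exI[of _ c] conjI ballI impI)
    fix v assume "v \<in> I"
    show "0 < c v" unfolding c_def using s1[of "to_nat_on I v"] by linarith
    show "b v \<le> c v" using sB[of "to_nat_on I v"] \<open>v \<in> I\<close> assms by (auto simp: c_def B_def)
  next
    fix v w assume "v \<in> I" "w \<in> I" "v \<noteq> w"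
    then have "to_nat_on I v < to_nat_on I w \<or> to_nat_on I w < to_nat_on I v"
      using assms by (meson linorder_neqE_nat to_nat_on_inj)
    then have "2 * c v + 1 \<le> c w \<or> 2 * c w + 1 \<le> c v" "1 \<le> c v" "1 \<le> c w"
      unfolding c_def using sm s1 by blast+
    then show "1 + c w \<le> 2 * \<bar>c v - c w\<bar>" by (auto simp: abs_if)
  qed
qed

text \<open>A quantitative Vandermonde argument by induction on the number of nodes. Eliminating a
  node \<open>w\<close> multiplies each weight by \<open>c v - c w\<close> and the bound by at most
  \<open>1 + c w\<close>; sparseness makes the first factor at least half of the second, so every
  elimination loses only a factor 2, whatever the nodes are. Since the exponents start at 1, the
  bound on \<open>t v\<close> decays like \<open>1 / c v\<close>.\<close>

lemma sparse_power_sums_bound: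
  fixes c t :: "'v \<Rightarrow> real"
  assumes "finite S" "v \<in> S" "card S \<le> Suc R" "0 \<le> B"
    and "\<And>v. v \<in> S \<Longrightarrow> 0 < c v"
    and "\<And>v w. v \<in> S \<Longrightarrow> w \<in> S \<Longrightarrow> v \<noteq> w \<Longrightarrow> 1 + c w \<le> 2 * \<bar>c v - c w\<bar>"
    and "\<And>m. m \<in> {1..Suc R} \<Longrightarrow> \<bar>\<Sum>w\<in>S. t w * c w ^ m\<bar> \<le> B"
  shows "\<bar>t v\<bar> * c v \<le> 2 ^ R * B"
  using assms
proof (induction R arbitrary: S t B v)
  case 0
  then have "S = {v}"
    by (metis One_nat_def card_le_Suc0_iff_eq is_singletonI' is_singleton_the_elem empty_iff insert_iff)
  then show ?case using 0(7)[of 1] 0(5)[of v] by (auto simp: abs_mult)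
next
  case (Suc R)
  show ?case
  proof (cases "S = {v}")
    case True
    have "B \<le> 2 ^ Suc R * B" using Suc.prems(4) mult_right_mono[of 1 "2 ^ Suc R" B] one_le_power[of "2::real" "Suc R"] by simp
    then show ?thesis using True Suc.prems(7)[of 1] Suc.prems(5)[of v] by (auto simp: abs_mult)
  next
    case False
    then obtain w where w: "w \<in> S" "w \<noteq> v" using Suc.prems(2) by blast
    \<comment> \<open>Subtracting c w times one power sum from the next one eliminates the node w.\<close>
    have 1: "\<bar>t v * (c v - c w)\<bar> * c v \<le> 2 ^ R * (B * (1 + c w))"
    proof (rule Suc.IH[where S = "S - {w}"])
      show "card (S - {w}) \<le> Suc R" using Suc.prems w by simp
      show "0 \<le> B * (1 + c w)" using Suc.prems(4) Suc.prems(5)[of w] w by auto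
      fix m assume m: "m \<in> {1..Suc R}"
      have "(\<Sum>u\<in>S - {w}. t u * (c u - c w) * c u ^ m) = (\<Sum>u\<in>S. t u * (c u - c w) * c u ^ m)"
        using Suc.prems w by (subst (2) sum.remove[where x = w]) auto
      also have "\<dots> = (\<Sum>u\<in>S. t u * c u ^ Suc m) - c w * (\<Sum>u\<in>S. t u * c u ^ m)"
        by (simp add: algebra_simps sum_subtractf sum_distrib_left)
      finally have e: "(\<Sum>u\<in>S - {w}. t u * (c u - c w) * c u ^ m) = \<dots>" .
      have "\<bar>\<Sum>u\<in>S. t u * c u ^ Suc m\<bar> \<le> B" "\<bar>\<Sum>u\<in>S. t u * c u ^ m\<bar> \<le> B"
        using Suc.prems(7)[of "Suc m"] Suc.prems(7)[of m] m by auto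
      moreover have "\<bar>c w * (\<Sum>u\<in>S. t u * c u ^ m)\<bar> \<le> c w * B"
        using calculation(2) Suc.prems(5)[of w] w by (auto simp: abs_mult)
      ultimately show "\<bar>\<Sum>u\<in>S - {w}. t u * (c u - c w) * c u ^ m\<bar> \<le> B * (1 + c w)"
        unfolding e by (simp add: algebra_simps)
    qed (use Suc.prems w in auto)
    have 2: "1 + c w \<le> 2 * \<bar>c v - c w\<bar>" using Suc.prems w by auto
    have pos: "1 + c w > 0" "c v > 0" using Suc.prems(5)[of w] Suc.prems(5)[of v] w Suc.prems(2) by auto
    have "(\<bar>t v\<bar> * c v) * (1 + c w) \<le> (\<bar>t v\<bar> * c v) * (2 * \<bar>c v - c w\<bar>)"
      using 2 pos by (intro mult_left_mono) auto
    also have "\<dots> = 2 * (\<bar>t v * (c v - c w)\<bar> * c v)" by (simp add: abs_mult)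
    also have "\<dots> \<le> 2 * (2 ^ R * (B * (1 + c w)))" using 1 by simp
    finally have "(\<bar>t v\<bar> * c v) * (1 + c w) \<le> (2 ^ Suc R * B) * (1 + c w)" by simp
    then show ?thesis using pos by simp
  qed
qed

section \<open>Covers of bounded order\<close>

text \<open>The factors \<open>\<Sum>W\<in>S. max 0 (w V - w W)\<close> vanish as soon as \<open>n + 1\<close> other
  functions are at least as large as \<open>w V\<close>, which keeps the order of the cover off \<open>F\<close>.\<close>

lemma truncated_family_order:
  fixes w :: "'v \<Rightarrow> 'a \<Rightarrow> real"
  assumes u: "\<And>V. V \<in> I \<Longrightarrow> u V x = w V x *
      (\<Prod>S\<in>{S. S \<subseteq> I - {V} \<and> card S = Suc n}. \<Sum>W\<in>S. max 0 (w V x - w W x))"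
    and fin: "finite I"
  shows "card {V \<in> I. u V x \<noteq> 0} \<le> Suc n"
proof (rule ccontr)
  assume "\<not> ?thesis"
  then have "Suc (Suc n) \<le> card {V \<in> I. u V x \<noteq> 0}" by simp
  then obtain A where A: "A \<subseteq> {V \<in> I. u V x \<noteq> 0}" "card A = Suc (Suc n)" "finite A"
    by (rule obtain_subset_with_card_n) (rule that)
  \<comment> \<open>Among \<open>n + 2\<close> functions that are nonzero at \<open>x\<close>, the
    one smallest there has \<open>n + 1\<close> competitors at least as large. These form one of the
    sets \<open>S\<close>, whose factor is zero.\<close>
  then obtain V where V: "V \<in> A" "\<And>W. W \<in> A \<Longrightarrow> w V x \<le> w W x"
    using arg_min_if_finite[of A "\<lambda>V. w V x"] by (metis card.empty not_less old.nat.distinct(1))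
  have fin': "finite {S. S \<subseteq> I - {V} \<and> card S = Suc n}" using fin by simp
  have "A - {V} \<in> {S. S \<subseteq> I - {V} \<and> card S = Suc n}" using A V by auto
  moreover have "(\<Sum>W\<in>A - {V}. max 0 (w V x - w W x)) = 0" using V by (intro sum.neutral) auto
  ultimately have "u V x = 0" using fin' V(1) A(1) by (subst u) (auto simp: prod_zero_iff)
  then show False using A V by auto
qed

text \<open>Only \<open>K\<close> has to be covered, but the bound \<open>n\<close>, which counts
  members, holds on all of \<open>X\<close>. This asymmetry lets families belonging to different
  closed sets be united with the bounds added.\<close>

definition cover_family :: "'a topology \<Rightarrow> 'a set \<Rightarrow> nat \<Rightarrow> ('a \<Rightarrow> real) set \<Rightarrow> bool" where
  "cover_family X K n G \<longleftrightarrow> finite G \<and>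
     (\<forall>u\<in>G. continuous_map X euclideanreal u \<and> (\<forall>x\<in>topspace X. 0 \<le> u x)) \<and>
     (\<forall>x\<in>topspace X. card {u \<in> G. u x \<noteq> 0} \<le> n) \<and> (\<forall>x\<in>K. \<exists>u\<in>G. u x \<noteq> 0)"

text \<open>A cozero refinement on \<open>F\<close> is carried to \<open>X\<close> by Tietze
  extension. The extended functions may overlap too often off \<open>F\<close>, so they are
  truncated; the truncation forces the order everywhere and is harmless on \<open>F\<close>, where
  the order was already right.\<close>

lemma covering_dim_family:
  assumes X: "normal_space X" and F: "closedin X F" and dim: "covering_dim_le (subtopology X F) n"
    and J: "finite J" "\<And>j. j \<in> J \<Longrightarrow> continuous_map X euclideanreal (a j)"
    and cov: "\<And>x. x \<in> F \<Longrightarrow> \<exists>j\<in>J. a j x \<noteq> 0"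
  shows "\<exists>G. cover_family X F (Suc n) G \<and> (\<forall>u\<in>G. \<exists>j\<in>J. \<forall>x\<in>topspace X. u x \<noteq> 0 \<longrightarrow> a j x \<noteq> 0)"
proof -
  have FX: "F \<subseteq> topspace X" and tF: "topspace (subtopology X F) = F"
    using closedin_subset[OF F] by auto
  define UU where "UU = (\<lambda>j. {x \<in> F. a j x \<noteq> 0}) ` J"
  have "finite_cozero_cover (subtopology X F) UU"
    unfolding finite_cozero_cover_def cozero_in_def tF UU_def
  proof (intro conjI ballI)
    fix U assume "U \<in> (\<lambda>j. {x \<in> F. a j x \<noteq> 0}) ` J"
    then obtain j where "j \<in> J" "U = {x \<in> F. a j x \<noteq> 0}" by auto
    then show "\<exists>f. continuous_map (subtopology X F) euclideanreal f \<and> U = {x \<in> F. f x \<noteq> 0}"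
      using J continuous_map_from_subtopology by blast
  qed (use J cov in auto)
  then obtain \<V> where \<V>: "finite_cozero_cover (subtopology X F) \<V>" "\<And>V. V \<in> \<V> \<Longrightarrow> \<exists>U\<in>UU. V \<subseteq> U"
    "\<And>x. x \<in> F \<Longrightarrow> card {V \<in> \<V>. x \<in> V} \<le> n + 1"
    using dim unfolding covering_dim_le_def tF by metis
  have fin\<V>: "finite \<V>" and U\<V>: "\<Union>\<V> = F" using \<V>(1) tF by (auto simp: finite_cozero_cover_def)
  \<comment> \<open>Extending the absolute value inside \<open>{0..}\<close> gives a nonnegative
    function on \<open>X\<close> that still cuts \<open>V\<close> out of \<open>F\<close>.\<close>
  have "\<exists>w. continuous_map X euclideanreal w \<and> w ` topspace X \<subseteq> {0..} \<and> V = {x \<in> F. w x \<noteq> 0}" if "V \<in> \<V>" for V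
  proof -
    have "cozero_in (subtopology X F) V" using \<V>(1) that by (simp add: finite_cozero_cover_def)
    then obtain f where f: "continuous_map (subtopology X F) euclideanreal f" "V = {x \<in> F. f x \<noteq> 0}"
      unfolding cozero_in_def tF by (elim exE conjE) rule
    have "continuous_map (subtopology X F) euclideanreal (\<lambda>x. \<bar>f x\<bar>)"
      using f by (intro continuous_intros)
    then obtain g where "continuous_map X euclideanreal g" "g ` topspace X \<subseteq> {0..}" "\<And>x. x \<in> F \<Longrightarrow> g x = \<bar>f x\<bar>"
      by (rule Tietze_extension_realinterval[OF X F, of "{0::real..}", rotated 2]) (auto simp: is_interval_ci)
    then show ?thesis using f by (intro exI[of _ g]) auto
  qed
  then obtain w0 where w0: "\<And>V. V \<in> \<V> \<Longrightarrow> continuous_map X euclideanreal (w0 V)"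
    "\<And>V x. V \<in> \<V> \<Longrightarrow> x \<in> topspace X \<Longrightarrow> 0 \<le> w0 V x" "\<And>V. V \<in> \<V> \<Longrightarrow> V = {x \<in> F. w0 V x \<noteq> 0}"
    unfolding image_subset_iff atLeast_iff by metis
  have "\<exists>j\<in>J. \<forall>x\<in>V. a j x \<noteq> 0" if "V \<in> \<V>" for V
    using \<V>(2)[OF that] unfolding UU_def by blast
  then obtain jj where jj: "\<And>V. V \<in> \<V> \<Longrightarrow> jj V \<in> J" "\<And>V x. V \<in> \<V> \<Longrightarrow> x \<in> V \<Longrightarrow> a (jj V) x \<noteq> 0"
    by metis
  \<comment> \<open>The minimum with \<open>\<bar>a (jj V) x\<bar>\<close> makes the refinement hold
    on all of \<open>X\<close>. On \<open>F\<close> nothing is lost, since \<open>a (jj V)\<close>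
    has no zero on \<open>V\<close>.\<close>
  define w where "w V x = min (w0 V x) \<bar>a (jj V) x\<bar>" for V x
  define u where "u V x = w V x * (\<Prod>S\<in>{S. S \<subseteq> \<V> - {V} \<and> card S = Suc n}. \<Sum>W\<in>S. max 0 (w V x - w W x))" for V x
  have wc: "continuous_map X euclideanreal (w V)" if "V \<in> \<V>" for V
    unfolding w_def using w0 J jj that by (intro continuous_intros) auto
  have w_ge: "0 \<le> w V x" if "V \<in> \<V>" "x \<in> topspace X" for V x
    using w0(2)[OF that] by (auto simp: w_def)
  have wF: "w V x \<noteq> 0 \<longleftrightarrow> x \<in> V" if "V \<in> \<V>" "x \<in> F" for V x
  proof -
    have "x \<in> V \<longleftrightarrow> w0 V x \<noteq> 0" using w0(3)[OF that(1)] that(2) by blast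
    then show ?thesis using jj(2)[of V x] that w0(2)[of V x] FX by (auto simp: w_def min_def)
  qed
  have ord: "card {V \<in> \<V>. u V x \<noteq> 0} \<le> Suc n" for x
    by (rule truncated_family_order[of \<V> u x w n]) (use fin\<V> in \<open>auto simp: u_def\<close>)
  show ?thesis
    unfolding cover_family_def
  proof (intro exI[of _ "u ` \<V>"] conjI ballI)
    show "finite (u ` \<V>)" using fin\<V> by simp
  next
    fix v assume "v \<in> u ` \<V>"
    then obtain V where V: "V \<in> \<V>" "v = u V" by auto
    have *: "finite S \<and> S \<subseteq> \<V>" if "S \<subseteq> \<V> - {V}" for S using that fin\<V> finite_subset by blast
    show "continuous_map X euclideanreal v"
      unfolding V u_def
      by (intro continuous_map_real_mult continuous_map_prod continuous_map_sum continuous_map_real_max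
          continuous_map_diff wc V) (use fin\<V> * in auto)
    show "\<exists>j\<in>J. \<forall>x\<in>topspace X. v x \<noteq> 0 \<longrightarrow> a j x \<noteq> 0"
    proof (intro bexI[of _ "jj V"] ballI impI notI jj V)
      fix x assume x: "x \<in> topspace X" "v x \<noteq> 0" "a (jj V) x = 0"
      then have "w V x = 0" using w0(2)[OF V(1) x(1)] by (simp add: w_def)
      then show False using x(2) by (simp add: V u_def)
    qed
  next
    fix v x assume "v \<in> u ` \<V>" "x \<in> topspace X"
    then show "0 \<le> v x" using w_ge by (auto simp: u_def intro!: mult_nonneg_nonneg prod_nonneg sum_nonneg)
  next
    fix x assume "x \<in> topspace X"
    have "{v \<in> u ` \<V>. v x \<noteq> 0} = u ` {V \<in> \<V>. u V x \<noteq> 0}" by auto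
    then show "card {v \<in> u ` \<V>. v x \<noteq> 0} \<le> Suc n"
      using ord[of x] card_image_le[of "{V \<in> \<V>. u V x \<noteq> 0}" u] fin\<V> by auto
  next
    fix x assume x: "x \<in> F"
    then obtain V where V: "V \<in> \<V>" "x \<in> V" using U\<V> by blast
    have pos: "0 < w V x" using V wF[OF V(1) x] w_ge[OF V(1)] x FX by force
    \<comment> \<open>At most \<open>n + 1\<close> members of the refinement contain
      \<open>x\<close>, whereas \<open>V\<close> and \<open>S\<close> make \<open>n + 2\<close>. So
      some \<open>W\<close> in \<open>S\<close> misses \<open>x\<close>, and its summand is
      \<open>w V x\<close>.\<close>
    have "0 < (\<Sum>W\<in>S. max 0 (w V x - w W x))" if S: "S \<subseteq> \<V> - {V}" "card S = Suc n" for S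
    proof -
      have "\<not> insert V S \<subseteq> {V \<in> \<V>. x \<in> V}"
      proof
        assume "insert V S \<subseteq> {V \<in> \<V>. x \<in> V}"
        then have "card (insert V S) \<le> n + 1"
          using \<V>(3)[OF x] fin\<V> card_mono[of "{V \<in> \<V>. x \<in> V}" "insert V S"] by auto
        moreover have "card (insert V S) = Suc (Suc n)" using S fin\<V>
          by (subst card_insert_disjoint) (auto intro: finite_subset[of S \<V>])
        ultimately show False by simp
      qed
      then obtain W where W: "W \<in> S" "w W x = 0" using V S wF[OF _ x] by blast
      show ?thesis
        by (rule sum_pos2[of _ W]) (use W S fin\<V> pos in \<open>auto intro: finite_subset[of S \<V>]\<close>)
    qed
    then have "u V x \<noteq> 0" using pos fin\<V> unfolding u_def by (auto simp: prod_zero_iff less_le)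
    then show "\<exists>v\<in>u ` \<V>. v x \<noteq> 0" using V by auto
  qed
qed

text \<open>The functions \<open>e y k\<close> are tents over a grid of mesh 1/2 in the cube
  coordinates \<open>\<Theta>\<close>. A cell has side 1, so it lies in one member of the given
  cover, and at most \<open>2 ^ card M\<close> cells contain a point. Merging the cells assigned to
  the same member makes the infinite grid a finite cover.\<close>

lemma cubical_refinement:
  fixes \<Theta> :: "'m \<Rightarrow> 'a \<Rightarrow> real"
  assumes M: "finite M" and \<Theta>: "\<And>m. m \<in> M \<Longrightarrow> continuous_map Z euclideanreal (\<Theta> m)"
    and fin: "finite \<U>"
    and leb: "\<And>y. y \<in> topspace Z \<Longrightarrow>
      \<exists>U\<in>\<U>. \<forall>y'\<in>topspace Z. (\<forall>m\<in>M. \<bar>\<Theta> m y - \<Theta> m y'\<bar> \<le> 1) \<longrightarrow> y' \<in> U"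
  shows "\<exists>\<V>. finite_cozero_cover Z \<V> \<and> (\<forall>V\<in>\<V>. \<exists>U\<in>\<U>. V \<subseteq> U) \<and>
    (\<forall>y\<in>topspace Z. card {V \<in> \<V>. y \<in> V} \<le> 2 ^ card M)"
proof -
  define e where "e y k = (\<Prod>m\<in>M. max 0 (1 - \<bar>2 * \<Theta> m y - real_of_int (k m)\<bar>))" for y and k :: "'m \<Rightarrow> int"
  define fl where "fl y = (\<Pi>\<^sub>E m\<in>M. {\<lfloor>2 * \<Theta> m y\<rfloor>, \<lfloor>2 * \<Theta> m y\<rfloor> + 1})" for y
  have e_nz: "e y k \<noteq> 0 \<longleftrightarrow> (\<forall>m\<in>M. \<bar>2 * \<Theta> m y - k m\<bar> < 1)" for y k
    unfolding e_def using M by (auto simp: prod_zero_iff max_def)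
  have e_ge: "0 \<le> e y k" for y k unfolding e_def by (intro prod_nonneg) auto
  have fl_fin: "finite (fl y)" for y unfolding fl_def using M by (intro finite_PiE) auto
  have fl_card: "card (fl y) = 2 ^ card M" for y unfolding fl_def using M by (simp add: card_PiE numeral_2_eq_2)
  have e_fl: "k \<in> fl y" if "e y k \<noteq> 0" "k \<in> extensional M" for y k
    unfolding fl_def
  proof (rule PiE_I)
    fix m assume "m \<in> M"
    then have "\<bar>2 * \<Theta> m y - k m\<bar> < 1" using that e_nz by auto
    then have "k m = \<lfloor>2 * \<Theta> m y\<rfloor> \<or> k m = \<lfloor>2 * \<Theta> m y\<rfloor> + 1" by linarith
    then show "k m \<in> {\<lfloor>2 * \<Theta> m y\<rfloor>, \<lfloor>2 * \<Theta> m y\<rfloor> + 1}" by auto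
  qed (use that in \<open>auto simp: extensional_def\<close>)
  have e_floor: "e y (\<lambda>m\<in>M. \<lfloor>2 * \<Theta> m y\<rfloor>) \<noteq> 0" for y
    unfolding e_nz by (auto; linarith)
  have "\<exists>U\<in>\<U>. \<forall>y'\<in>topspace Z. e y' k \<noteq> 0 \<longrightarrow> y' \<in> U" if ex: "\<exists>y\<in>topspace Z. e y k \<noteq> 0" for k
  proof -
    obtain y where y: "y \<in> topspace Z" "e y k \<noteq> 0" using ex by auto
    obtain U where U: "U \<in> \<U>" "\<And>y'. y' \<in> topspace Z \<Longrightarrow> (\<forall>m\<in>M. \<bar>\<Theta> m y - \<Theta> m y'\<bar> \<le> 1) \<Longrightarrow> y' \<in> U"
      using leb[OF y(1)] by auto
    show ?thesis
    proof (intro bexI[of _ U] ballI impI U)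
      fix y' m assume "e y' k \<noteq> 0" "m \<in> M"
      then have "\<bar>2 * \<Theta> m y - k m\<bar> < 1" "\<bar>2 * \<Theta> m y' - k m\<bar> < 1" using y e_nz by auto
      then show "\<bar>\<Theta> m y - \<Theta> m y'\<bar> \<le> 1" by linarith
    qed
  qed
  \<comment> \<open>For an empty cell \<open>J k\<close> is arbitrary; such cells contribute to none
    of the sets \<open>W U\<close>.\<close>
  then obtain J where J: "\<And>k. \<exists>y\<in>topspace Z. e y k \<noteq> 0 \<Longrightarrow> J k \<in> \<U>"
    "\<And>k y. y \<in> topspace Z \<Longrightarrow> e y k \<noteq> 0 \<Longrightarrow> y \<in> J k"
    by metis
  define W where "W U = {y \<in> topspace Z. \<exists>k\<in>extensional M. J k = U \<and> e y k \<noteq> 0}" for U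
  \<comment> \<open>The sum runs over the corners of the grid cube around \<open>y\<close>, the only
    indices in \<open>extensional M\<close> where a tent can be nonzero. It is finite, but its index
    set moves with \<open>y\<close>, so continuity needs an argument.\<close>
  define w where "w U y = (\<Sum>k\<in>{k \<in> fl y. J k = U}. e y k)" for U y
  have w_nz: "w U y \<noteq> 0 \<longleftrightarrow> (\<exists>k\<in>extensional M. J k = U \<and> e y k \<noteq> 0)" for U y
  proof -
    have "w U y = 0 \<longleftrightarrow> (\<forall>k\<in>{k \<in> fl y. J k = U}. e y k = 0)"
      unfolding w_def using fl_fin e_ge by (intro sum_nonneg_eq_0_iff) auto
    moreover have "fl y \<subseteq> extensional M" by (auto simp: fl_def PiE_def)
    ultimately show ?thesis using e_fl by blast
  qed
  have w_cont: "continuous_map Z euclideanreal (w U)" for U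
  proof (rule continuous_map_local_agreement)
    show "continuous_map Z euclideanreal (\<lambda>y. \<Sum>m\<in>M. \<bar>\<Theta> m y\<bar>)"
      using M \<Theta> by (intro continuous_intros)
    \<comment> \<open>Where all coordinates are below \<open>b\<close> in absolute value, every
      index in \<open>fl y\<close> lies in this fixed finite box, so \<open>w U\<close> agrees there
      with a sum of continuous functions over a fixed set.\<close>
    define P where "P b = (\<Pi>\<^sub>E m\<in>M. {- 2 * int b - 2..2 * int b + 2})" for b
    have Pfin: "finite (P b)" for b unfolding P_def using M by (intro finite_PiE) auto
    show "continuous_map Z euclideanreal (\<lambda>y. \<Sum>k\<in>{k \<in> P b. J k = U}. e y k)" for b
      unfolding e_def using M Pfin[of b] by (intro continuous_intros \<Theta>) auto
    fix y b assume y: "y \<in> topspace Z" "(\<Sum>m\<in>M. \<bar>\<Theta> m y\<bar>) < real b"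
    have le: "\<bar>\<Theta> m y\<bar> < real b" if "m \<in> M" for m
      using member_le_sum[of m M "\<lambda>m. \<bar>\<Theta> m y\<bar>"] that M y by force
    have "fl y \<subseteq> P b"
      unfolding fl_def P_def
    proof (rule PiE_mono)
      fix m assume "m \<in> M"
      then have "\<bar>\<Theta> m y\<bar> < real b" by (rule le)
      then have "- 2 * int b - 2 \<le> \<lfloor>2 * \<Theta> m y\<rfloor>" "\<lfloor>2 * \<Theta> m y\<rfloor> + 1 \<le> 2 * int b + 2" by linarith+
      then show "{\<lfloor>2 * \<Theta> m y\<rfloor>, \<lfloor>2 * \<Theta> m y\<rfloor> + 1} \<subseteq> {- 2 * int b - 2..2 * int b + 2}" by auto
    qed
    moreover have "P b \<subseteq> extensional M" by (auto simp: P_def PiE_def)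
    ultimately show "w U y = (\<Sum>k\<in>{k \<in> P b. J k = U}. e y k)"
      unfolding w_def using Pfin[of b] e_fl by (intro sum.mono_neutral_left) auto
  qed
  show ?thesis
  proof (intro exI[of _ "W ` \<U>"] conjI ballI)
    have "W U = {y \<in> topspace Z. w U y \<noteq> 0}" for U unfolding W_def w_nz by auto
    then have "cozero_in Z (W U)" for U unfolding cozero_in_def using w_cont by blast
    moreover have "y \<in> \<Union>(W ` \<U>)" if "y \<in> topspace Z" for y
      using that J(1) e_floor[of y] unfolding W_def by (auto intro!: bexI[of _ "\<lambda>m\<in>M. \<lfloor>2 * \<Theta> m y\<rfloor>"])
    ultimately show "finite_cozero_cover Z (W ` \<U>)"
      unfolding finite_cozero_cover_def using fin by (auto simp: W_def)
    have "W U \<subseteq> U" for U using J(2) unfolding W_def by blast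
    then show "\<exists>U\<in>\<U>. V \<subseteq> U" if "V \<in> W ` \<U>" for V using that by blast
    fix y assume y: "y \<in> topspace Z"
    have "{V \<in> W ` \<U>. y \<in> V} \<subseteq> (\<lambda>k. W (J k)) ` fl y" using e_fl by (auto simp: W_def)
    then show "card {V \<in> W ` \<U>. y \<in> V} \<le> 2 ^ card M"
      using fl_card[of y] surj_card_le[OF fl_fin, of "{V \<in> W ` \<U>. y \<in> V}" "\<lambda>k. W (J k)" y] by simp
  qed
qed

section \<open>Functionals on spaces of continuous functions\<close>

lemma normal_Hausdorff_bump:
  assumes "normal_space X" "Hausdorff_space X" "closedin X C" "x \<in> topspace X" "x \<notin> C"
  obtains e where "continuous_map X euclideanreal e" "e x = 1"
    "\<And>z. z \<in> topspace X \<Longrightarrow> 0 \<le> e z \<and> e z \<le> 1" "\<And>z. z \<in> C \<Longrightarrow> e z = 0"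
proof -
  have C: "closedin X (insert x C)"
    using closedin_Un[OF closedin_Hausdorff_singleton[OF assms(2,4)] assms(3)] by simp
  have "continuous_map (subtopology X (insert x C)) euclideanreal (\<lambda>z. if z = x then 1 else 0)"
  proof (rule pasting_lemma_closed[where I = "{0::nat,1}" and T = "\<lambda>i. if i = 0 then C else {x}"
         and f = "\<lambda>i z. if i = 0 then 0 else 1"])
    show "closedin (subtopology X (insert x C)) (if i = 0 then C else {x})" for i :: nat
      using assms closedin_Hausdorff_singleton[OF assms(2,4)]
      by (auto intro: closedin_subset_topspace)
  qed (use assms in auto)
  then obtain g where "continuous_map X euclideanreal g" "\<And>z. z \<in> insert x C \<Longrightarrow> g z = (if z = x then 1 else 0)"
      "g ` topspace X \<subseteq> {0..1}"
    by (rule Tietze_extension_closed_real_interval[OF assms(1) C, of _ 0 1]) auto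
  then show thesis using assms(5) by (intro that[of g]) auto
qed

text \<open>Start from bumps that vanish at the other points of \<open>S\<close> and on
  \<open>C\<close>. From each subtract the sum of the others and cut off at 0: where the result is
  positive, that bump exceeds every other one, which cannot happen for two bumps at the same
  point.\<close>

lemma disjoint_bumps:
  assumes X: "normal_space X" "Hausdorff_space X" and C: "closedin X C"
    and S: "finite S" "S \<subseteq> topspace X" "S \<inter> C = {}"
  obtains e :: "'a \<Rightarrow> 'a \<Rightarrow> real" where
    "\<And>x. x \<in> S \<Longrightarrow> continuous_map X euclideanreal (e x)"
    "\<And>x. x \<in> S \<Longrightarrow> e x x = 1"
    "\<And>x z. x \<in> S \<Longrightarrow> z \<in> topspace X \<Longrightarrow> 0 \<le> e x z \<and> e x z \<le> 1"
    "\<And>x x' z. x \<in> S \<Longrightarrow> x' \<in> S \<Longrightarrow> x \<noteq> x' \<Longrightarrow> z \<in> topspace X \<Longrightarrow> e x z * e x' z = 0"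
    "\<And>x z. x \<in> S \<Longrightarrow> z \<in> C \<Longrightarrow> e x z = 0"
proof -
  have CX: "C \<subseteq> topspace X" using C by (rule closedin_subset)
  have "\<exists>e. continuous_map X euclideanreal e \<and> e x = 1 \<and> (\<forall>z\<in>topspace X. 0 \<le> e z \<and> e z \<le> 1) \<and>
      (\<forall>z\<in>(S - {x}) \<union> C. e z = 0)" if x: "x \<in> S" for x
  proof -
    have "closedin X ((S - {x}) \<union> C)"
      using closedin_Un[OF closedin_Hausdorff_finite[OF X(2)] C, of "S - {x}"] S by auto
    then obtain e where "continuous_map X euclideanreal e" "e x = 1"
      "\<And>z. z \<in> topspace X \<Longrightarrow> 0 \<le> e z \<and> e z \<le> 1" "\<And>z. z \<in> (S - {x}) \<union> C \<Longrightarrow> e z = 0"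
      by (rule normal_Hausdorff_bump[OF X]) (use x S in auto)
    then show ?thesis by blast
  qed
  then obtain e where e: "\<And>x. x \<in> S \<Longrightarrow> continuous_map X euclideanreal (e x)"
    "\<And>x. x \<in> S \<Longrightarrow> e x x = 1" "\<And>x z. x \<in> S \<Longrightarrow> z \<in> topspace X \<Longrightarrow> 0 \<le> e x z \<and> e x z \<le> 1"
    "\<And>x z. x \<in> S \<Longrightarrow> z \<in> (S - {x}) \<union> C \<Longrightarrow> e x z = 0"
    by metis
  define g where "g x z = max 0 (e x z - (\<Sum>x'\<in>S - {x}. e x' z))" for x z
  show thesis
  proof (rule that[of g])
    fix x assume x: "x \<in> S"
    show "continuous_map X euclideanreal (g x)"
      unfolding g_def using e(1) x S(1) by (intro continuous_intros) auto
    have "(\<Sum>x'\<in>S - {x}. e x' x) = 0" using e(4) x by (intro sum.neutral) auto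
    then show "g x x = 1" using e(2)[OF x] by (simp add: g_def)
    show "0 \<le> g x z \<and> g x z \<le> 1" if z: "z \<in> topspace X" for z
    proof -
      have "0 \<le> (\<Sum>x'\<in>S - {x}. e x' z)" using e(3)[OF _ z] by (intro sum_nonneg) auto
      then show ?thesis using e(3)[OF x z] by (auto simp: g_def)
    qed
    show "g x z = 0" if z: "z \<in> C" for z
    proof -
      have "0 \<le> (\<Sum>x'\<in>S - {x}. e x' z)" using e(3)[of _ z] z CX by (intro sum_nonneg) auto
      then show ?thesis using e(4)[OF x, of z] z by (auto simp: g_def)
    qed
    fix x' z assume x': "x' \<in> S" "x \<noteq> x'" and z: "z \<in> topspace X"
    have "e x' z \<le> (\<Sum>x'\<in>S - {x}. e x' z)" "e x z \<le> (\<Sum>x\<in>S - {x'}. e x z)"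
      using e(3)[OF _ z] x x' S(1) by (auto intro!: member_le_sum)
    then show "g x z * g x' z = 0" by (auto simp: g_def max_def)
  qed
qed

lemma closedin_Collect_all:
  assumes "\<And>i. closedin Y {y \<in> topspace Y. P i y}"
  shows "closedin Y {y \<in> topspace Y. \<forall>i. P i y}"
proof -
  have "{y \<in> topspace Y. \<forall>i. P i y} = (\<Inter>i. {y \<in> topspace Y. P i y})" by auto
  then show ?thesis using closedin_INT[of UNIV Y "\<lambda>i. {y \<in> topspace Y. P i y}"] assms by simp
qed

lemma closedin_Collect_imp:
  assumes "A \<Longrightarrow> closedin Y {y \<in> topspace Y. P y}"
  shows "closedin Y {y \<in> topspace Y. A \<longrightarrow> P y}"
  using assms by (cases A) auto

section \<open>Linear operators between the function spaces\<close>

locale pointwise_surjection =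
  fixes X :: "'a topology" and Y :: "'b topology"
    and DX :: "('a \<Rightarrow> real) set" and DY :: "('b \<Rightarrow> real) set"
    and T :: "('a \<Rightarrow> real) \<Rightarrow> 'b \<Rightarrow> real"
  assumes normX: "normal_space X" and HausX: "Hausdorff_space X"
    and normY: "normal_space Y"
    and DX_cases: "DX = cont_funs X \<or> DX = bdd_cont_funs X"
    and DY_cases: "DY = cont_funs Y \<or> DY = bdd_cont_funs Y"
    and linear: "linear_operator_on X Y DX T"
    and contT: "continuous_map (pointwise_topology X DX) (pointwise_topology Y DY) T"
    and surjT: "T ` DX = DY"
begin

lemma DX_continuous: "f \<in> DX \<Longrightarrow> continuous_map X euclideanreal f"
  using DX_cases by (auto simp: cont_funs_def bdd_cont_funs_def)

lemma DY_continuous: "g \<in> DY \<Longrightarrow> continuous_map Y euclideanreal g"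
  using DY_cases by (auto simp: cont_funs_def bdd_cont_funs_def)

lemma T_continuous: "f \<in> DX \<Longrightarrow> continuous_map Y euclideanreal (T f)"
  using surjT DY_continuous by blast

lemma restrict_in_cont_funs:
  "continuous_map Z euclideanreal f \<Longrightarrow> restrict f (topspace Z) \<in> cont_funs Z"
  by (auto simp: cont_funs_def intro: continuous_map_eq)

text \<open>The boundedness premise is conditional so that both choices of \<open>DX\<close> are
  served by one argument.\<close>

lemma restrict_in_DX:
  assumes "continuous_map X euclideanreal f" "DX \<noteq> cont_funs X \<Longrightarrow> bounded (f ` topspace X)"
  shows "restrict f (topspace X) \<in> DX"
proof -
  have "restrict f (topspace X) ` topspace X = f ` topspace X" by auto
  then show ?thesis using DX_cases restrict_in_cont_funs[OF assms(1)] assms(2)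
    by (cases "DX = cont_funs X") (auto simp: bdd_cont_funs_def)
qed

lemma restrict_in_DY:
  assumes "continuous_map Y euclideanreal f" "bounded (f ` topspace Y)"
  shows "restrict f (topspace Y) \<in> DY"
proof -
  have "restrict f (topspace Y) ` topspace Y = f ` topspace Y" by auto
  then show ?thesis using DY_cases restrict_in_cont_funs[OF assms(1)] assms(2)
    by (auto simp: bdd_cont_funs_def)
qed

lemma zero_in_DX: "(\<lambda>x\<in>topspace X. 0) \<in> DX"
  by (rule restrict_in_DX) (auto simp: image_constant_conv)

lemma DX_bounded: "f \<in> DX \<Longrightarrow> DX \<noteq> cont_funs X \<Longrightarrow> bounded (f ` topspace X)"
  using DX_cases by (auto simp: bdd_cont_funs_def)

lemma scale_in_DX:
  assumes "f \<in> DX"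
  shows "(\<lambda>x\<in>topspace X. c * f x) \<in> DX"
proof (rule restrict_in_DX)
  show "continuous_map X euclideanreal (\<lambda>x. c * f x)"
    using DX_continuous[OF assms] by (intro continuous_intros)
  assume "DX \<noteq> cont_funs X"
  then show "bounded ((\<lambda>x. c * f x) ` topspace X)"
    using bounded_scaling[OF DX_bounded[OF assms]] by (simp add: image_image)
qed

lemma add_in_DX:
  assumes "f \<in> DX" "g \<in> DX"
  shows "(\<lambda>x\<in>topspace X. f x + g x) \<in> DX"
proof (rule restrict_in_DX)
  show "continuous_map X euclideanreal (\<lambda>x. f x + g x)"
    using DX_continuous assms by (intro continuous_intros)
  assume "DX \<noteq> cont_funs X"
  then show "bounded ((\<lambda>x. f x + g x) ` topspace X)"
    using bounded_plus_comp DX_bounded assms by blast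
qed

lemma T_add:
  assumes "f \<in> DX" "g \<in> DX" "y \<in> topspace Y"
  shows "T (\<lambda>x\<in>topspace X. f x + g x) y = T f y + T g y"
  using linear assms by (auto simp: linear_operator_on_def)

lemma T_scale:
  assumes "f \<in> DX" "y \<in> topspace Y"
  shows "T (\<lambda>x\<in>topspace X. c * f x) y = c * T f y"
  using linear assms by (auto simp: linear_operator_on_def)

text \<open>Membership and value are proved together because additivity of \<open>T\<close> is
  available only for functions in \<open>DX\<close>.\<close>

lemma T_sum:
  assumes "finite S" "\<And>i. i \<in> S \<Longrightarrow> f i \<in> DX" "y \<in> topspace Y"
  shows "(\<lambda>x\<in>topspace X. \<Sum>i\<in>S. k i * f i x) \<in> DX \<and>
    T (\<lambda>x\<in>topspace X. \<Sum>i\<in>S. k i * f i x) y = (\<Sum>i\<in>S. k i * T (f i) y)"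
  using assms
proof (induction S rule: finite_induct)
  case empty
  have "(\<lambda>x\<in>topspace X. 0 * (\<lambda>x\<in>topspace X. 0::real) x) = (\<lambda>x\<in>topspace X. 0)" by auto
  then have "T (\<lambda>x\<in>topspace X. 0) y = 0" using T_scale[OF zero_in_DX assms(3), of 0] by simp
  then show ?case unfolding sum.empty using zero_in_DX by blast
next
  case (insert j S)
  have e: "(\<lambda>x\<in>topspace X. \<Sum>i\<in>insert j S. k i * f i x) =
      (\<lambda>x\<in>topspace X. (\<lambda>x\<in>topspace X. k j * f j x) x + (\<lambda>x\<in>topspace X. \<Sum>i\<in>S. k i * f i x) x)"
    using insert by auto
  have 1: "(\<lambda>x\<in>topspace X. k j * f j x) \<in> DX"
    "T (\<lambda>x\<in>topspace X. k j * f j x) y = k j * T (f j) y"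
    using scale_in_DX T_scale insert.prems by blast+
  have 2: "(\<lambda>x\<in>topspace X. \<Sum>i\<in>S. k i * f i x) \<in> DX"
    "T (\<lambda>x\<in>topspace X. \<Sum>i\<in>S. k i * f i x) y = (\<Sum>i\<in>S. k i * T (f i) y)"
    using insert.IH insert.prems by blast+
  show ?case unfolding e unfolding sum.insert[OF insert.hyps]
    using add_in_DX[OF 1(1) 2(1)] T_add[OF 1(1) 2(1) assms(3)] 1(2) 2(2) by argo
qed

section \<open>Evaluations of the image as finite combinations\<close>

definition represents :: "'b \<Rightarrow> 'a set \<Rightarrow> ('a \<Rightarrow> real) \<Rightarrow> bool" where
  "represents y S \<mu> \<longleftrightarrow> finite S \<and> S \<subseteq> topspace X \<and> (\<forall>x\<in>S. \<mu> x \<noteq> 0) \<and>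
     (\<forall>f\<in>DX. T f y = (\<Sum>x\<in>S. \<mu> x * f x))"

text \<open>Continuity at zero gives a basic neighbourhood, restricting only finitely many
  coordinates, on which the functional \<open>T f y\<close> is below 1 in absolute value. If
  \<open>f\<close> vanishes at these coordinates, all its multiples stay in the neighbourhood, which
  forces the value 0.\<close>

lemma T_vanishes_off_finite:
  assumes y: "y \<in> topspace Y"
  shows "\<exists>S. finite S \<and> S \<subseteq> topspace X \<and> (\<forall>f\<in>DX. (\<forall>x\<in>S. f x = 0) \<longrightarrow> T f y = 0)"
proof -
  have tDX: "topspace (pointwise_topology X DX) = DX"
    using DX_cases by (intro topspace_pointwise_topology) (auto simp: bdd_cont_funs_def)
  have "continuous_map (pointwise_topology Y DY) euclideanreal (\<lambda>g. g y)"
    unfolding pointwise_topology_def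
    by (intro continuous_map_from_subtopology continuous_map_product_projection y)
  from continuous_map_compose[OF contT this]
  have "continuous_map (pointwise_topology X DX) euclideanreal (\<lambda>f. T f y)" by (simp add: o_def)
  then have "openin (pointwise_topology X DX) {f \<in> topspace (pointwise_topology X DX). T f y \<in> {-1<..<1}}"
    by (rule openin_continuous_map_preimage) auto
  then obtain Q where Q: "openin (powertop_real (topspace X)) Q" "{f \<in> DX. T f y \<in> {-1<..<1}} = Q \<inter> DX"
    unfolding tDX unfolding pointwise_topology_def openin_subtopology by auto
  then have Q_iff: "f \<in> Q \<longleftrightarrow> \<bar>T f y\<bar> < 1" if "f \<in> DX" for f
    using that by (simp add: set_eq_iff abs_less_iff) (metis minus_less_iff)
  define z where "z = (\<lambda>x\<in>topspace X. 0::real)"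
  have zDX: "z \<in> DX" unfolding z_def by (rule zero_in_DX)
  have "T z y = 0" using T_sum[of "{}" undefined y] y by (simp add: z_def)
  then have "z \<in> Q" using Q_iff[OF zDX] by simp
  have "\<exists>U. finite {i \<in> topspace X. U i \<noteq> topspace euclideanreal} \<and>
      (\<forall>i\<in>topspace X. openin euclideanreal (U i)) \<and> z \<in> Pi\<^sub>E (topspace X) U \<and> Pi\<^sub>E (topspace X) U \<subseteq> Q"
    using Q(1) \<open>z \<in> Q\<close> unfolding openin_product_topology_alt by (rule bspec)
  then obtain U where U: "finite {i \<in> topspace X. U i \<noteq> UNIV}"
    "z \<in> Pi\<^sub>E (topspace X) U" "Pi\<^sub>E (topspace X) U \<subseteq> Q"
    unfolding topspace_euclidean by (elim exE conjE) (rule that)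
  have "T f y = 0" if f: "f \<in> DX" "\<forall>x\<in>{i \<in> topspace X. U i \<noteq> UNIV}. f x = 0" for f
  proof -
    have small: "\<bar>c * T f y\<bar> < 1" for c
    proof -
      have "(\<lambda>x\<in>topspace X. c * f x) \<in> Pi\<^sub>E (topspace X) U"
      proof (rule PiE_I)
        fix x assume x: "x \<in> topspace X"
        have "z x \<in> U x" using U(2) x by auto
        then have "0 \<in> U x" using x by (simp add: z_def)
        then show "(\<lambda>x\<in>topspace X. c * f x) x \<in> U x" using f(2) x by (cases "U x = UNIV") auto
      qed auto
      then have "(\<lambda>x\<in>topspace X. c * f x) \<in> Q" by (rule subsetD[OF U(3)])
      then show ?thesis using Q_iff[OF scale_in_DX[OF f(1)]] T_scale[OF f(1) y] by metis
    qed
    show "T f y = 0"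
    proof (rule ccontr)
      assume "T f y \<noteq> 0"
      then show False using small[of "inverse (T f y)"] by simp
    qed
  qed
  then show ?thesis using U(1) by (intro exI[of _ "{i \<in> topspace X. U i \<noteq> UNIV}"]) auto
qed

lemma coordinate_functions:
  assumes S: "finite S" "S \<subseteq> topspace X"
  shows "\<exists>E. \<forall>x\<in>S. E x \<in> DX \<and> E x x = 1 \<and> (\<forall>z\<in>topspace X. 0 \<le> E x z \<and> E x z \<le> 1) \<and>
      (\<forall>x'\<in>S. x \<noteq> x' \<longrightarrow> E x x' = 0 \<and> (\<forall>z\<in>topspace X. E x z * E x' z = 0))"
proof -
  obtain e where e: "\<And>x. x \<in> S \<Longrightarrow> continuous_map X euclideanreal (e x)"
    "\<And>x. x \<in> S \<Longrightarrow> e x x = 1"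
    "\<And>x z. x \<in> S \<Longrightarrow> z \<in> topspace X \<Longrightarrow> 0 \<le> e x z \<and> e x z \<le> 1"
    "\<And>x x' z. x \<in> S \<Longrightarrow> x' \<in> S \<Longrightarrow> x \<noteq> x' \<Longrightarrow> z \<in> topspace X \<Longrightarrow> e x z * e x' z = 0"
    by (rule disjoint_bumps[OF normX HausX closedin_empty S]) auto
  have e0: "e x x' = 0" if "x \<in> S" "x' \<in> S" "x \<noteq> x'" for x x'
    using e(4)[of x x' x'] e(2)[of x'] that S(2) by auto
  define E where "E x = restrict (e x) (topspace X)" for x
  have E: "E x \<in> DX" if "x \<in> S" for x
    unfolding E_def
  proof (rule restrict_in_DX[OF e(1)[OF that]])
    show "bounded (e x ` topspace X)"
      using e(3)[OF that] by (intro boundedI[of _ 1]) auto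
  qed
  have SX: "x \<in> topspace X" if "x \<in> S" for x using that S(2) by auto
  show ?thesis
    by (rule exI[of _ E]) (use E e e0 SX in \<open>simp add: E_def\<close>)
qed

text \<open>Subtracting from \<open>f\<close> the combination of coordinate functions with the same
  values on \<open>S\<close> leaves a function that vanishes on \<open>S\<close>, which the
  functional annihilates. So the coefficients are the values of the functional on the coordinate
  functions.\<close>

lemma ex_represents:
  assumes y: "y \<in> topspace Y"
  obtains S \<mu> where "represents y S \<mu>"
proof -
  obtain S where S: "finite S" "S \<subseteq> topspace X" "\<forall>f\<in>DX. (\<forall>x\<in>S. f x = 0) \<longrightarrow> T f y = 0"
    using T_vanishes_off_finite[OF y] by blast
  obtain E where "\<forall>x\<in>S. E x \<in> DX \<and> E x x = 1 \<and> (\<forall>z\<in>topspace X. 0 \<le> E x z \<and> E x z \<le> 1) \<and>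
      (\<forall>x'\<in>S. x \<noteq> x' \<longrightarrow> E x x' = 0 \<and> (\<forall>z\<in>topspace X. E x z * E x' z = 0))"
    using coordinate_functions[OF S(1,2)] by blast
  then have E: "\<And>x. x \<in> S \<Longrightarrow> E x \<in> DX" "\<And>x. x \<in> S \<Longrightarrow> E x x = 1"
    and E01: "\<And>x z. x \<in> S \<Longrightarrow> z \<in> topspace X \<Longrightarrow> 0 \<le> E x z \<and> E x z \<le> 1"
    and Edis: "\<And>x x' z. x \<in> S \<Longrightarrow> x' \<in> S \<Longrightarrow> x \<noteq> x' \<Longrightarrow> z \<in> topspace X \<Longrightarrow> E x z * E x' z = 0"
    and E0: "\<And>x x'. x \<in> S \<Longrightarrow> x' \<in> S \<Longrightarrow> x \<noteq> x' \<Longrightarrow> E x x' = 0"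
    by blast+
  define \<mu> where "\<mu> x = T (E x) y" for x
  have rep: "T f y = (\<Sum>x\<in>S. \<mu> x * f x)" if f: "f \<in> DX" for f
  proof -
    let ?s = "\<lambda>z\<in>topspace X. \<Sum>x\<in>S. (- f x) * E x z"
    have s: "?s \<in> DX" "T ?s y = (\<Sum>x\<in>S. (- f x) * T (E x) y)"
      using T_sum[OF S(1) E(1) y, where k = "\<lambda>x. - f x"] by auto
    have "T (\<lambda>z\<in>topspace X. f z + ?s z) y = 0"
    proof (rule S(3)[rule_format, OF add_in_DX[OF f s(1)]])
      fix z assume z: "z \<in> S"
      have "(\<Sum>x\<in>S. (- f x) * E x z) = (- f z) * E z z"
        using z E0 by (subst sum.remove[OF S(1) z]) (auto intro!: sum.neutral)
      then show "(\<lambda>z\<in>topspace X. f z + ?s z) z = 0" using z S(2) E(2)[OF z] by auto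
    qed
    then show ?thesis using T_add[OF f s(1) y] s(2) by (simp add: \<mu>_def sum_negf mult.commute)
  qed
  \<comment> \<open>Dropping the zero coefficients makes the finite set the exact support, so that
    its cardinality is meaningful.\<close>
  have "represents y {x \<in> S. \<mu> x \<noteq> 0} \<mu>"
    unfolding represents_def using S rep by (auto intro!: sum.mono_neutral_cong_right)
  then show thesis by (rule that)
qed

text \<open>The points whose functionals are supported on at most \<open>q\<close> points of \<open>K\<close> and have norm at
  most \<open>p\<close>, described by conditions that are visibly closed.\<close>

definition piece :: "'a set \<Rightarrow> nat \<Rightarrow> nat \<Rightarrow> 'b set" where
  "piece K q p = {y \<in> topspace Y.
     (\<forall>f. f \<in> DX \<and> (\<forall>x\<in>K. f x = 0) \<longrightarrow> T f y = 0) \<and>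
     (\<forall>f. f \<in> DX \<and> (\<forall>x\<in>topspace X. \<bar>f x\<bar> \<le> 1) \<longrightarrow> \<bar>T f y\<bar> \<le> real p) \<and>
     (\<forall>f. (\<forall>i\<le>q. f i \<in> DX) \<and> (\<forall>i\<le>q. \<forall>j\<le>q. i \<noteq> j \<longrightarrow> (\<forall>x\<in>topspace X. f i x * f j x = 0))
        \<longrightarrow> (\<Prod>i\<le>q. T (f i) y) = 0)}"

text \<open>For a fixed test function or family each clause is a closed condition on a continuous
  function of \<open>y\<close>, and all the quantifiers amount to intersections.\<close>

lemma closedin_piece: "closedin Y (piece K q p)"
proof -
  have 0: "closedin Y {y \<in> topspace Y. h y = 0}" if "continuous_map Y euclideanreal h" for h :: "'b \<Rightarrow> real"
    using closedin_continuous_map_preimage[OF that, of "{0}"] by simp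
  have 1: "closedin Y {y \<in> topspace Y. \<bar>h y\<bar> \<le> r}" if "continuous_map Y euclideanreal h" for h :: "'b \<Rightarrow> real" and r
    using closedin_continuous_map_preimage[OF that, of "{-r..r}"] by (simp add: abs_le_iff minus_le_iff conj_commute)
  have conj: "{y \<in> topspace Y. P y \<and> Q y \<and> R y} = {y \<in> topspace Y. P y} \<inter> {y \<in> topspace Y. Q y} \<inter> {y \<in> topspace Y. R y}"
    for P Q R by auto
  show ?thesis
    unfolding piece_def conj
    by (intro closedin_Int closedin_Collect_all closedin_Collect_imp 0 1 continuous_map_prod)
       (auto intro: T_continuous)
qed

lemma piece_subset: "piece K q p \<subseteq> topspace Y"
  by (auto simp: piece_def)

lemma represents_imp_piece:
  assumes y: "y \<in> topspace Y" and rep: "represents y S \<mu>"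
    and "S \<subseteq> K" "card S \<le> q" "(\<Sum>x\<in>S. \<bar>\<mu> x\<bar>) \<le> real p"
  shows "y \<in> piece K q p"
proof -
  have S: "finite S" "S \<subseteq> topspace X" and Tf: "\<And>f. f \<in> DX \<Longrightarrow> T f y = (\<Sum>x\<in>S. \<mu> x * f x)"
    using rep by (auto simp: represents_def)
  show ?thesis
    unfolding piece_def
  proof (intro CollectI conjI allI impI y; (elim conjE)?)
    fix f assume "f \<in> DX" "\<forall>x\<in>K. f x = 0"
    then show "T f y = 0" using Tf assms(3) by (auto intro!: sum.neutral)
  next
    fix f assume f: "f \<in> DX" "\<forall>x\<in>topspace X. \<bar>f x\<bar> \<le> 1"
    have "\<bar>T f y\<bar> \<le> (\<Sum>x\<in>S. \<bar>\<mu> x * f x\<bar>)" unfolding Tf[OF f(1)] by (rule sum_abs)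
    also have "\<dots> \<le> (\<Sum>x\<in>S. \<bar>\<mu> x\<bar>)"
      using f(2) S by (intro sum_mono) (auto simp: abs_mult intro!: mult_left_le)
    finally show "\<bar>T f y\<bar> \<le> real p" using assms(5) by simp
  next
    fix f assume f: "\<forall>i\<le>q. f i \<in> DX"
      and dis: "\<forall>i\<le>q. \<forall>j\<le>q. i \<noteq> j \<longrightarrow> (\<forall>x\<in>topspace X. f i x * f j x = 0)"
    show "(\<Prod>i\<le>q. T (f i) y) = 0"
    proof (rule ccontr)
      assume "(\<Prod>i\<le>q. T (f i) y) \<noteq> 0"
      then have nz: "T (f i) y \<noteq> 0" if "i \<le> q" for i using that by (simp add: prod_zero_iff)
      \<comment> \<open>Each of the \<open>q + 1\<close> functions must be nonzero somewhere on the
        support, and their products vanish, so the chosen points are distinct. The support has at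
        most \<open>q\<close> points.\<close>
      have "\<exists>x\<in>S. f i x \<noteq> 0" if "i \<le> q" for i
      proof (rule ccontr)
        assume "\<not> (\<exists>x\<in>S. f i x \<noteq> 0)"
        then have "(\<Sum>x\<in>S. \<mu> x * f i x) = 0" by (intro sum.neutral) auto
        then show False using nz[OF that] Tf[of "f i"] f that by simp
      qed
      then obtain s where s: "\<And>i. i \<le> q \<Longrightarrow> s i \<in> S \<and> f i (s i) \<noteq> 0" by metis
      have "inj_on s {..q}"
      proof (rule inj_onI, rule ccontr)
        fix i j assume "i \<in> {..q}" "j \<in> {..q}" "s i = s j" "i \<noteq> j"
        then show False using s[of i] s[of j] dis S by (metis atMost_iff mult_eq_0_iff subsetD)
      qed
      then have "card {..q} \<le> card S" using s S by (intro card_inj_on_le) auto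
      then show False using assms(4) by simp
    qed
  qed
qed

text \<open>Each clause of \<open>piece\<close> is tested on bumps adapted to the support: one bump
  isolates a coefficient outside \<open>K\<close>, \<open>q + 1\<close> disjoint bumps give a
  nonzero product, and a signed combination of disjoint bumps attains the norm.\<close>

lemma piece_represents:
  assumes K: "closedin X K" and y: "y \<in> piece K q p"
  obtains S \<mu> where "represents y S \<mu>" "S \<subseteq> K" "card S \<le> q" "(\<Sum>x\<in>S. \<bar>\<mu> x\<bar>) \<le> real p"
proof -
  have yY: "y \<in> topspace Y" using y piece_subset by blast
  note y' = y[unfolded piece_def mem_Collect_eq, THEN conjunct2]
  have p1: "T f y = 0" if "f \<in> DX" "\<And>x. x \<in> K \<Longrightarrow> f x = 0" for f
    using y'[THEN conjunct1] that by blast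
  have p2: "\<bar>T f y\<bar> \<le> real p" if "f \<in> DX" "\<And>x. x \<in> topspace X \<Longrightarrow> \<bar>f x\<bar> \<le> 1" for f
    using y'[THEN conjunct2, THEN conjunct1] that by blast
  have p3: "(\<Prod>i\<le>q. T (f i) y) = 0" if "\<And>i. i \<le> q \<Longrightarrow> f i \<in> DX"
    "\<And>i j x. i \<le> q \<Longrightarrow> j \<le> q \<Longrightarrow> i \<noteq> j \<Longrightarrow> x \<in> topspace X \<Longrightarrow> f i x * f j x = 0" for f
    by (rule y'[THEN conjunct2, THEN conjunct2, rule_format]) (use that in blast)
  obtain S \<mu> where rep: "represents y S \<mu>" using ex_represents[OF yY] .
  have S: "finite S" "S \<subseteq> topspace X" "\<And>x. x \<in> S \<Longrightarrow> \<mu> x \<noteq> 0"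
    and Tf: "\<And>f. f \<in> DX \<Longrightarrow> T f y = (\<Sum>x\<in>S. \<mu> x * f x)"
    using rep by (auto simp: represents_def)
  obtain E where "\<forall>x\<in>S. E x \<in> DX \<and> E x x = 1 \<and> (\<forall>z\<in>topspace X. 0 \<le> E x z \<and> E x z \<le> 1) \<and>
      (\<forall>x'\<in>S. x \<noteq> x' \<longrightarrow> E x x' = 0 \<and> (\<forall>z\<in>topspace X. E x z * E x' z = 0))"
    using coordinate_functions[OF S(1,2)] by blast
  then have E: "\<And>x. x \<in> S \<Longrightarrow> E x \<in> DX" "\<And>x. x \<in> S \<Longrightarrow> E x x = 1"
    and E01: "\<And>x z. x \<in> S \<Longrightarrow> z \<in> topspace X \<Longrightarrow> 0 \<le> E x z \<and> E x z \<le> 1"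
    and Edis: "\<And>x x' z. x \<in> S \<Longrightarrow> x' \<in> S \<Longrightarrow> x \<noteq> x' \<Longrightarrow> z \<in> topspace X \<Longrightarrow> E x z * E x' z = 0"
    and E0: "\<And>x x'. x \<in> S \<Longrightarrow> x' \<in> S \<Longrightarrow> x \<noteq> x' \<Longrightarrow> E x x' = 0"
    by blast+
  have TE: "T (E x) y = \<mu> x" if x: "x \<in> S" for x
  proof -
    have "(\<Sum>z\<in>S. \<mu> z * E x z) = \<mu> x * E x x"
      using x E0[OF x] by (subst sum.remove[OF S(1) x]) (auto intro!: sum.neutral, metis)
    then show ?thesis using Tf[OF E(1)[OF x]] E(2)[OF x] by auto
  qed
  show thesis
  proof (rule that[OF rep])
    show "S \<subseteq> K"
    proof
      fix x assume x: "x \<in> S"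
      show "x \<in> K"
      proof (rule ccontr)
        assume "x \<notin> K"
        have "closedin X (K \<union> (S - {x}))"
          using closedin_Un[OF K closedin_Hausdorff_finite[OF HausX], of "S - {x}"] S by auto
        then obtain h where h: "continuous_map X euclideanreal h" "h x = 1"
          "\<And>z. z \<in> topspace X \<Longrightarrow> 0 \<le> h z \<and> h z \<le> 1" "\<And>z. z \<in> K \<union> (S - {x}) \<Longrightarrow> h z = 0"
          by (rule normal_Hausdorff_bump[OF normX HausX]) (use x S \<open>x \<notin> K\<close> in auto)
        have hD: "restrict h (topspace X) \<in> DX"
          using h by (intro restrict_in_DX boundedI[of _ 1]) auto
        have "T (restrict h (topspace X)) y = 0"
          using h(4) closedin_subset[OF K] by (intro p1[OF hD]) auto
        moreover have "(\<Sum>z\<in>S - {x}. \<mu> z * restrict h (topspace X) z) = 0"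
        proof (intro sum.neutral ballI)
          fix z assume "z \<in> S - {x}"
          then show "\<mu> z * restrict h (topspace X) z = 0" using h(4)[of z] S(2) by auto
        qed
        then have "(\<Sum>z\<in>S. \<mu> z * restrict h (topspace X) z) = \<mu> x * h x"
          using x S(2) by (subst sum.remove[OF S(1) x]) auto
        ultimately show False using Tf[OF hD] h(2) S(3)[OF x] by simp
      qed
    qed
    show "card S \<le> q"
    proof (rule ccontr)
      assume "\<not> card S \<le> q"
      then have "Suc q \<le> card S" by simp
      then obtain A where A: "A \<subseteq> S" "card A = Suc q" "finite A"
        by (rule obtain_subset_with_card_n) (rule that)
      then obtain s where s: "bij_betw s {0..<Suc q} A"
        using ex_bij_betw_nat_finite[OF A(3)] A(2) by auto
      have sS: "s i \<in> S" if "i \<le> q" for i using s A(1) that by (auto simp: bij_betw_def)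
      have "(\<Prod>i\<le>q. T (E (s i)) y) = 0"
      proof (rule p3)
        fix i j x assume ij: "i \<le> q" "j \<le> q" "i \<noteq> j" "x \<in> topspace X"
        then have "s i \<noteq> s j" using s by (auto simp: bij_betw_def inj_on_def)
        then show "E (s i) x * E (s j) x = 0" using Edis[OF sS sS] ij by simp
      qed (use E sS in auto)
      then show False using TE sS S(3) by (auto simp: prod_zero_iff)
    qed
    show "(\<Sum>x\<in>S. \<bar>\<mu> x\<bar>) \<le> real p"
    proof -
      \<comment> \<open>The bumps have disjoint cozero sets, so this combination is bounded by 1,
        while the functional takes the sum of the absolute coefficients on it.\<close>
      let ?f = "\<lambda>z\<in>topspace X. \<Sum>x\<in>S. sgn (\<mu> x) * E x z"
      have f: "?f \<in> DX" "T ?f y = (\<Sum>x\<in>S. sgn (\<mu> x) * T (E x) y)"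
        using T_sum[OF S(1) E(1) yY, where k = "\<lambda>x. sgn (\<mu> x)"] by auto
      have "\<bar>T ?f y\<bar> \<le> real p"
      proof (rule p2[OF f(1)])
        fix z assume z: "z \<in> topspace X"
        show "\<bar>?f z\<bar> \<le> 1"
        proof (cases "\<exists>x\<in>S. E x z \<noteq> 0")
          case True
          then obtain x where x: "x \<in> S" "E x z \<noteq> 0" by auto
          have "(\<Sum>x\<in>S. sgn (\<mu> x) * E x z) = sgn (\<mu> x) * E x z"
            using Edis[OF x(1) _ _ z] x by (subst sum.remove[OF S(1) x(1)]) (auto intro!: sum.neutral, metis)
          then show ?thesis using z E01[OF x(1) z] by (simp add: abs_mult abs_sgn_eq)
        qed (use z in simp)
      qed
      also have "T ?f y = (\<Sum>x\<in>S. \<bar>\<mu> x\<bar>)" unfolding f(2) using TE by (simp add: abs_sgn mult.commute)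
      finally show ?thesis by simp
    qed
  qed
qed

end

section \<open>Fine partitions of unity\<close>

text \<open>The order bound of each family holds on all of \<open>X\<close> and not just on its own
  closed set, so the bounds add up in the union.\<close>

lemma covering_dim_family_Union:
  assumes X: "normal_space X" and H: "finite \<H>" "\<And>F. F \<in> \<H> \<Longrightarrow> closedin X F"
      "\<And>F. F \<in> \<H> \<Longrightarrow> covering_dim_le (subtopology X F) (d F)"
    and J: "finite J" "\<And>j. j \<in> J \<Longrightarrow> continuous_map X euclideanreal (a j)"
    and cov: "\<And>x. x \<in> \<Union>\<H> \<Longrightarrow> \<exists>j\<in>J. a j x \<noteq> 0"
  shows "\<exists>G. cover_family X (\<Union>\<H>) (\<Sum>F\<in>\<H>. Suc (d F)) G \<and>
    (\<forall>u\<in>G. \<exists>j\<in>J. \<forall>x\<in>topspace X. u x \<noteq> 0 \<longrightarrow> a j x \<noteq> 0)"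
proof -
  have "\<exists>G. cover_family X F (Suc (d F)) G \<and> (\<forall>u\<in>G. \<exists>j\<in>J. \<forall>x\<in>topspace X. u x \<noteq> 0 \<longrightarrow> a j x \<noteq> 0)"
    if F: "F \<in> \<H>" for F
  proof -
    have cov': "\<exists>j\<in>J. a j x \<noteq> 0" if "x \<in> F" for x using cov F that by blast
    show ?thesis
      by (rule covering_dim_family[OF X H(2)[OF F] H(3)[OF F] J cov'])
  qed
  then obtain G where G': "\<And>F. F \<in> \<H> \<Longrightarrow> cover_family X F (Suc (d F)) (G F)"
    and Gr: "\<And>F u. F \<in> \<H> \<Longrightarrow> u \<in> G F \<Longrightarrow> \<exists>j\<in>J. \<forall>x\<in>topspace X. u x \<noteq> 0 \<longrightarrow> a j x \<noteq> 0"
    by metis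
  have G: "\<And>F. F \<in> \<H> \<Longrightarrow> finite (G F)"
    "\<And>F u. F \<in> \<H> \<Longrightarrow> u \<in> G F \<Longrightarrow> continuous_map X euclideanreal u \<and> (\<forall>x\<in>topspace X. 0 \<le> u x)"
    "\<And>F x. F \<in> \<H> \<Longrightarrow> x \<in> topspace X \<Longrightarrow> card {u \<in> G F. u x \<noteq> 0} \<le> Suc (d F)"
    "\<And>F x. F \<in> \<H> \<Longrightarrow> x \<in> F \<Longrightarrow> \<exists>u\<in>G F. u x \<noteq> 0"
    using G' unfolding cover_family_def by blast+
  have card: "card {u \<in> \<Union>(G ` \<H>). u x \<noteq> 0} \<le> (\<Sum>F\<in>\<H>. Suc (d F))" if "x \<in> topspace X" for x
  proof -
    have "{u \<in> \<Union>(G ` \<H>). u x \<noteq> 0} = (\<Union>F\<in>\<H>. {u \<in> G F. u x \<noteq> 0})" by auto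
    then have "card {u \<in> \<Union>(G ` \<H>). u x \<noteq> 0} \<le> (\<Sum>F\<in>\<H>. card {u \<in> G F. u x \<noteq> 0})"
      using card_UN_le[OF H(1)] by simp
    also have "\<dots> \<le> (\<Sum>F\<in>\<H>. Suc (d F))" using G(3) that by (intro sum_mono) auto
    finally show ?thesis .
  qed
  have "cover_family X (\<Union>\<H>) (\<Sum>F\<in>\<H>. Suc (d F)) (\<Union>(G ` \<H>))"
    unfolding cover_family_def
  proof (intro conjI ballI card)
    show "finite (\<Union>(G ` \<H>))" using H(1) G(1) by blast
    show "\<exists>u\<in>\<Union>(G ` \<H>). u x \<noteq> 0" if "x \<in> \<Union>\<H>" for x using that G(4) by blast
  qed (use G(2) in blast)+
  then show ?thesis using Gr by blast
qed

text \<open>The cover used consists of preimages of cubes of radius \<open>e\<close> centred at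
  multiples of \<open>e\<close>, and \<open>\<beta>\<close> records the centres. Truncating the
  functions at height \<open>A\<close> leaves finitely many cubes, at the price that the estimate is
  claimed only where the truncation changes nothing.\<close>

lemma fine_family:
  fixes f :: "'j \<Rightarrow> 'a \<Rightarrow> real"
  assumes X: "normal_space X" and H: "finite \<H>" "\<And>F. F \<in> \<H> \<Longrightarrow> closedin X F"
      "\<And>F. F \<in> \<H> \<Longrightarrow> covering_dim_le (subtopology X F) (d F)"
    and J: "finite J" "\<And>j. j \<in> J \<Longrightarrow> continuous_map X euclideanreal (f j)"
    and e: "0 < e"
  shows "\<exists>G \<beta>. cover_family X (\<Union>\<H>) (\<Sum>F\<in>\<H>. Suc (d F)) G \<and>
    (\<forall>u\<in>G. \<forall>x\<in>topspace X. u x \<noteq> 0 \<longrightarrow> (\<forall>j\<in>J. \<bar>f j x\<bar> \<le> A \<longrightarrow> \<bar>f j x - \<beta> u j\<bar> \<le> e))"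
proof -
  define g where "g j x = max (- \<bar>A\<bar>) (min \<bar>A\<bar> (f j x))" for j x
  define L where "L = \<lceil>\<bar>A\<bar> / e\<rceil>"
  define P where "P = (\<Pi>\<^sub>E j\<in>J. {-L..L})"
  define a where "a k x = (\<Prod>j\<in>J. max 0 (e - \<bar>g j x - of_int (k j) * e\<bar>))" for k :: "'j \<Rightarrow> int" and x
  have g_le: "\<bar>g j x\<bar> \<le> \<bar>A\<bar>" for j x by (auto simp: g_def)
  have Pfin: "finite P" unfolding P_def using J by (intro finite_PiE) auto
  have ac: "continuous_map X euclideanreal (a k)" for k
    unfolding a_def g_def using J by (intro continuous_intros) auto
  have a_nz: "a k x \<noteq> 0 \<longleftrightarrow> (\<forall>j\<in>J. \<bar>g j x - of_int (k j) * e\<bar> < e)" for k x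
    unfolding a_def using J by (auto simp: prod_zero_iff max_def)
  have cov: "\<exists>k\<in>P. a k x \<noteq> 0" for x
  proof (intro bexI[of _ "\<lambda>j\<in>J. \<lfloor>g j x / e\<rfloor>"])
    have "\<bar>g j x - of_int \<lfloor>g j x / e\<rfloor> * e\<bar> < e" for j
    proof -
      have "of_int \<lfloor>g j x / e\<rfloor> * e \<le> g j x" "g j x < (of_int \<lfloor>g j x / e\<rfloor> + 1) * e"
        using e floor_divide_lower[OF e, of "g j x"] floor_divide_upper[OF e, of "g j x"] by auto
      then show ?thesis by (simp add: algebra_simps)
    qed
    then show "a (\<lambda>j\<in>J. \<lfloor>g j x / e\<rfloor>) x \<noteq> 0" unfolding a_nz by simp
    have "\<lfloor>g j x / e\<rfloor> \<in> {-L..L}" for j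
    proof -
      have "\<bar>g j x / e\<bar> \<le> \<bar>A\<bar> / e" using g_le[of j x] e by (simp add: divide_right_mono)
      also have "\<dots> \<le> of_int L" unfolding L_def by (rule le_of_int_ceiling)
      finally have "- of_int L \<le> g j x / e" "g j x / e \<le> of_int L" unfolding abs_le_iff by linarith+
      then have "- L \<le> \<lfloor>g j x / e\<rfloor>" "\<lfloor>g j x / e\<rfloor> \<le> L" by linarith+
      then show ?thesis by simp
    qed
    then show "(\<lambda>j\<in>J. \<lfloor>g j x / e\<rfloor>) \<in> P" unfolding P_def by auto
  qed
  obtain G where G: "cover_family X (\<Union>\<H>) (\<Sum>F\<in>\<H>. Suc (d F)) G"
    "\<forall>u\<in>G. \<exists>k\<in>P. \<forall>x\<in>topspace X. u x \<noteq> 0 \<longrightarrow> a k x \<noteq> 0"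
    using covering_dim_family_Union[OF X H Pfin ac cov] by blast
  then obtain k where k: "\<And>u x. u \<in> G \<Longrightarrow> x \<in> topspace X \<Longrightarrow> u x \<noteq> 0 \<Longrightarrow> a (k u) x \<noteq> 0"
    by metis
  have "\<bar>f j x - of_int (k u j) * e\<bar> \<le> e" if "u \<in> G" "x \<in> topspace X" "u x \<noteq> 0" "j \<in> J" "\<bar>f j x\<bar> \<le> A" for u x j
  proof -
    have "g j x = f j x" using that(5) by (auto simp: g_def)
    then show ?thesis using k[OF that(1-3)] that(4) a_nz by fastforce
  qed
  then show ?thesis
    using G by (intro exI[of _ G] exI[of _ "\<lambda>u j. of_int (k u j) * e"]) auto
qed

text \<open>A partition of unity on \<open>K\<close>, possibly infinite, with
  \<open>\<beta> V j\<close> an approximate value of \<open>f j\<close> on the cozero set of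
  \<open>\<phi> V\<close>. Sums run over the members nonzero at the point because a sum over an
  infinite set defaults to 0. The last clause serves bounded function spaces, where the weighted
  sums have to be bounded.\<close>

definition fine_partition :: "'a topology \<Rightarrow> 'a set \<Rightarrow> nat \<Rightarrow> 'j set \<Rightarrow> ('j \<Rightarrow> 'a \<Rightarrow> real) \<Rightarrow> real \<Rightarrow>
    'v set \<Rightarrow> ('v \<Rightarrow> 'a \<Rightarrow> real) \<Rightarrow> ('v \<Rightarrow> 'j \<Rightarrow> real) \<Rightarrow> bool" where
  "fine_partition X K n J f e I \<phi> \<beta> \<longleftrightarrow> countable I \<and> (\<forall>V. \<forall>x\<in>K. 0 \<le> \<phi> V x) \<and>
     (\<forall>x\<in>K. finite {V \<in> I. \<phi> V x \<noteq> 0} \<and> card {V \<in> I. \<phi> V x \<noteq> 0} \<le> n \<and>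
        (\<Sum>V | V \<in> I \<and> \<phi> V x \<noteq> 0. \<phi> V x) = 1) \<and>
     (\<forall>V\<in>I. \<forall>x\<in>K. \<phi> V x \<noteq> 0 \<longrightarrow> (\<forall>j\<in>J. \<bar>f j x - \<beta> V j\<bar> \<le> e)) \<and>
     (\<forall>c. continuous_map (subtopology X K) euclideanreal (\<lambda>x. \<Sum>V | V \<in> I \<and> \<phi> V x \<noteq> 0. c V * \<phi> V x)) \<and>
     ((\<forall>j\<in>J. bounded (f j ` K)) \<longrightarrow> finite I)"

lemma fine_partitionI:
  assumes
    "countable I"
    "\<And>V x. x \<in> K \<Longrightarrow> 0 \<le> \<phi> V x"
    "\<And>x. x \<in> K \<Longrightarrow> finite {V \<in> I. \<phi> V x \<noteq> 0}"
    "\<And>x. x \<in> K \<Longrightarrow> card {V \<in> I. \<phi> V x \<noteq> 0} \<le> n"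
    "\<And>x. x \<in> K \<Longrightarrow> (\<Sum>V | V \<in> I \<and> \<phi> V x \<noteq> 0. \<phi> V x) = 1"
    "\<And>V x j. V \<in> I \<Longrightarrow> x \<in> K \<Longrightarrow> \<phi> V x \<noteq> 0 \<Longrightarrow> j \<in> J \<Longrightarrow> \<bar>f j x - \<beta> V j\<bar> \<le> e"
    "\<And>c. continuous_map (subtopology X K) euclideanreal (\<lambda>x. \<Sum>V | V \<in> I \<and> \<phi> V x \<noteq> 0. c V * \<phi> V x)"
    "(\<And>j. j \<in> J \<Longrightarrow> bounded (f j ` K)) \<Longrightarrow> finite I"
  shows "fine_partition X K n J f e I \<phi> \<beta>"
  using assms unfolding fine_partition_def by blast

lemma fine_partitionD:
  assumes "fine_partition X K n J f e I \<phi> \<beta>"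
  shows
    "countable I"
    "\<And>V x. x \<in> K \<Longrightarrow> 0 \<le> \<phi> V x"
    "\<And>x. x \<in> K \<Longrightarrow> finite {V \<in> I. \<phi> V x \<noteq> 0}"
    "\<And>x. x \<in> K \<Longrightarrow> card {V \<in> I. \<phi> V x \<noteq> 0} \<le> n"
    "\<And>x. x \<in> K \<Longrightarrow> (\<Sum>V | V \<in> I \<and> \<phi> V x \<noteq> 0. \<phi> V x) = 1"
    "\<And>V x j. V \<in> I \<Longrightarrow> x \<in> K \<Longrightarrow> \<phi> V x \<noteq> 0 \<Longrightarrow> j \<in> J \<Longrightarrow> \<bar>f j x - \<beta> V j\<bar> \<le> e"
    "\<And>c. continuous_map (subtopology X K) euclideanreal (\<lambda>x. \<Sum>V | V \<in> I \<and> \<phi> V x \<noteq> 0. c V * \<phi> V x)"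
    "(\<And>j. j \<in> J \<Longrightarrow> bounded (f j ` K)) \<Longrightarrow> finite I"
  using assms unfolding fine_partition_def by blast+

text \<open>The functions \<open>f j\<close> may be unbounded, so finite covers are combined along the annuli
  \<open>\<bar>\<rho> - a\<bar> < 1\<close>; this doubles the order.\<close>

lemma fine_partition_of_unity:
  fixes f :: "'j \<Rightarrow> 'a \<Rightarrow> real"
  assumes X: "normal_space X" and H: "finite \<H>" "\<And>F. F \<in> \<H> \<Longrightarrow> closedin X F"
      "\<And>F. F \<in> \<H> \<Longrightarrow> covering_dim_le (subtopology X F) (d F)"
    and J: "finite J" "\<And>j. j \<in> J \<Longrightarrow> continuous_map X euclideanreal (f j)"
    and e: "0 < e"
  shows "\<exists>(I :: (nat \<times> ('a \<Rightarrow> real)) set) \<phi> \<beta>.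
    fine_partition X (\<Union>\<H>) (2 * (\<Sum>F\<in>\<H>. Suc (d F))) J f e I \<phi> \<beta>"
proof -
  define K where "K = \<Union>\<H>"
  have KX: "K \<subseteq> topspace X" unfolding K_def using H(2) closedin_subset by blast
  have tK: "topspace (subtopology X K) = K" using KX by auto
  define N where "N = (\<Sum>F\<in>\<H>. Suc (d F))"
  \<comment> \<open>The height \<open>n + 1\<close> suffices for layer \<open>n\<close>: where
    \<open>\<rho>\<close> is within 1 of \<open>n\<close>, every \<open>\<bar>f j x\<bar>\<close> is
    at most \<open>n + 1\<close>.\<close>
  have "\<exists>G \<beta>. cover_family X K N G \<and> (\<forall>u\<in>G. \<forall>x\<in>topspace X. u x \<noteq> 0 \<longrightarrow>
      (\<forall>j\<in>J. \<bar>f j x\<bar> \<le> real n + 1 \<longrightarrow> \<bar>f j x - \<beta> u j\<bar> \<le> e))" for n :: nat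
    unfolding N_def K_def by (rule fine_family[OF X H J e])
  then obtain G \<beta> where G'': "\<And>n. cover_family X K N (G n)"
    and G\<beta>: "\<And>n u x j. u \<in> G n \<Longrightarrow> x \<in> topspace X \<Longrightarrow> u x \<noteq> 0 \<Longrightarrow> j \<in> J \<Longrightarrow> \<bar>f j x\<bar> \<le> real n + 1 \<Longrightarrow>
      \<bar>f j x - \<beta> n u j\<bar> \<le> e"
    by metis
  note G' = G''[unfolded cover_family_def]
  have Gfin: "finite (G n)" for n using G' by blast
  have Gc: "continuous_map X euclideanreal u" if "u \<in> G n" for n u using G' that by blast
  have G0: "0 \<le> u x" if "u \<in> G n" "x \<in> topspace X" for n u x using G' that by blast
  have GN: "card {u \<in> G n. u x \<noteq> 0} \<le> N" if "x \<in> topspace X" for n x using G' that by blast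
  have Gcov: "\<exists>u\<in>G n. u x \<noteq> 0" if "x \<in> K" for n x using G' that by blast
  define \<rho> where "\<rho> x = (\<Sum>j\<in>J. \<bar>f j x\<bar>)" for x
  have \<rho>0: "0 \<le> \<rho> x" for x unfolding \<rho>_def by (intro sum_nonneg) auto
  have f\<rho>: "\<bar>f j x\<bar> \<le> \<rho> x" if "j \<in> J" for j x
    unfolding \<rho>_def using J(1) that by (intro member_le_sum) auto
  have \<rho>c: "continuous_map X euclideanreal \<rho>" unfolding \<rho>_def using J by (intro continuous_intros) auto
  define s where "s n x = (\<Sum>u\<in>G n. u x)" for n x
  have spos: "0 < s n x" if x: "x \<in> K" for n x
  proof -
    obtain u where "u \<in> G n" "u x \<noteq> 0" using Gcov[OF x] by blast
    then show ?thesis unfolding s_def using G0[of _ n x] Gfin x KX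
      by (intro sum_pos2[of _ u]) (auto simp: less_le)
  qed
  \<comment> \<open>These tents in \<open>\<rho>\<close> sum to 1, with only the two layers next to
    \<open>\<rho> x\<close> active at \<open>x\<close>. Each layer is weighted by its tent and
    carries the normalised family \<open>G n\<close>.\<close>
  define bmp where "bmp n x = max 0 (1 - \<bar>\<rho> x - real n\<bar>)" for n x
  define \<phi> where "\<phi> = (\<lambda>(n, u) x. bmp n x * (u x / s n x))"
  \<comment> \<open>Layers that miss \<open>K\<close> are discarded, so that the index set becomes
    finite when all \<open>f j\<close> are bounded on \<open>K\<close>.\<close>
  define I where "I = {(n, u). u \<in> G n \<and> (\<exists>x\<in>K. bmp n x \<noteq> 0)}"
  have bmp0: "0 \<le> bmp n x" for n x by (simp add: bmp_def)
  have bmp_nz: "bmp n x \<noteq> 0 \<longleftrightarrow> \<bar>\<rho> x - real n\<bar> < 1" for n x by (auto simp: bmp_def max_def)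
  define fl where "fl x = nat \<lfloor>\<rho> x\<rfloor>" for x
  have fl: "n = fl x \<or> n = Suc (fl x)" if "bmp n x \<noteq> 0" for n x
    using that \<rho>0[of x] unfolding bmp_nz fl_def by linarith
  have bmp_sum: "bmp (fl x) x + bmp (Suc (fl x)) x = 1" for x
  proof -
    have "real (fl x) = of_int \<lfloor>\<rho> x\<rfloor>" using \<rho>0[of x] by (simp add: fl_def)
    then have "real (fl x) \<le> \<rho> x" "\<rho> x < real (fl x) + 1" by linarith+
    then show ?thesis by (simp add: bmp_def)
  qed
  define Q where "Q x = Sigma {fl x, Suc (fl x)} (\<lambda>n. {u \<in> G n. u x \<noteq> 0})" for x
  have Qfin: "finite (Q x)" for x unfolding Q_def using Gfin by auto
  have sub: "{V \<in> I. \<phi> V x \<noteq> 0} \<subseteq> Q x" if "x \<in> K" for x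
    unfolding I_def \<phi>_def Q_def by (auto dest: fl)
  have \<phi>0: "0 \<le> \<phi> V x" if "x \<in> K" "V \<in> Sigma UNIV G" for V x
    using that G0 KX bmp0 spos[OF that(1)] unfolding \<phi>_def
    by (auto simp: case_prod_beta less_imp_le subset_iff intro!: mult_nonneg_nonneg divide_nonneg_nonneg)
  have \<phi>c: "continuous_map (subtopology X K) euclideanreal (\<phi> V)" if V: "V \<in> Sigma UNIV G" for V
  proof -
    obtain n u where nu: "V = (n, u)" "u \<in> G n" using V by auto
    have "s n x \<noteq> 0" if "x \<in> topspace (subtopology X K)" for x using spos[of x n] that tK by auto
    then have "continuous_map (subtopology X K) euclideanreal (\<lambda>x. bmp n x * (u x / s n x))"
      unfolding bmp_def s_def
      by (intro continuous_intros continuous_map_from_subtopology[OF \<rho>c] continuous_map_from_subtopology[OF Gc] Gfin)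
         (use nu(2) in auto)
    then show ?thesis by (simp add: nu(1) \<phi>_def)
  qed
  have ISigma: "I \<subseteq> Sigma UNIV G" by (auto simp: I_def)
  have eq: "{V \<in> I. (if V \<in> I then \<phi> V x else 0) \<noteq> 0} = {V \<in> I. \<phi> V x \<noteq> 0}" for x by auto
  have eq': "(\<Sum>V | V \<in> I \<and> (if V \<in> I then \<phi> V x else 0) \<noteq> 0. c V * (if V \<in> I then \<phi> V x else 0)) =
      (\<Sum>V | V \<in> I \<and> \<phi> V x \<noteq> 0. c V * \<phi> V x)" for x and c :: "nat \<times> ('a \<Rightarrow> real) \<Rightarrow> real"
    by (rule sum.cong) auto
  \<comment> \<open>Setting the functions to 0 off \<open>I\<close> gives the nonnegativity that
    \<open>fine_partition\<close> asks of every \<open>V\<close>.\<close>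
  have "fine_partition X K (2 * N) J f e I (\<lambda>V x. if V \<in> I then \<phi> V x else 0) (\<lambda>(n, u). \<beta> n u)"
  proof (rule fine_partitionI)
    show "countable I"
      by (rule countable_subset[OF ISigma]) (auto intro: countable_finite Gfin)
    fix x assume x: "x \<in> K"
    show "0 \<le> (if V \<in> I then \<phi> V x else 0)" for V using \<phi>0[OF x] ISigma by auto
    show "finite {V \<in> I. (if V \<in> I then \<phi> V x else 0) \<noteq> 0}"
      unfolding eq using Qfin sub[OF x] finite_subset by blast
    have "card {V \<in> I. \<phi> V x \<noteq> 0} \<le> card (Q x)" using Qfin sub[OF x] card_mono by blast
    also have "card (Q x) = (\<Sum>n\<in>{fl x, Suc (fl x)}. card {u \<in> G n. u x \<noteq> 0})"
      unfolding Q_def using Gfin by (intro card_SigmaI) auto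
    also have "\<dots> \<le> 2 * N" using GN[of x] x KX by (auto intro!: order_trans[OF add_mono[OF GN GN]])
    finally show "card {V \<in> I. (if V \<in> I then \<phi> V x else 0) \<noteq> 0} \<le> 2 * N" unfolding eq .
    have "(\<Sum>V | V \<in> I \<and> \<phi> V x \<noteq> 0. \<phi> V x) = (\<Sum>V\<in>Sigma {fl x, Suc (fl x)} G. \<phi> V x)"
    proof (rule sum.mono_neutral_left)
      show "finite (Sigma {fl x, Suc (fl x)} G)" using Gfin by auto
      show "{V \<in> I. \<phi> V x \<noteq> 0} \<subseteq> Sigma {fl x, Suc (fl x)} G" using sub[OF x] by (auto simp: Q_def)
      show "\<forall>V\<in>Sigma {fl x, Suc (fl x)} G - {V \<in> I. \<phi> V x \<noteq> 0}. \<phi> V x = 0"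
        using x by (auto simp: I_def \<phi>_def)
    qed
    also have "\<dots> = (\<Sum>n\<in>{fl x, Suc (fl x)}. \<Sum>u\<in>G n. \<phi> (n, u) x)"
      using Gfin by (subst sum.Sigma) auto
    also have "\<dots> = (\<Sum>n\<in>{fl x, Suc (fl x)}. bmp n x)"
    proof (rule sum.cong)
      fix n
      have "(\<Sum>u\<in>G n. \<phi> (n, u) x) = bmp n x * (s n x / s n x)"
        by (simp add: \<phi>_def s_def flip: sum_distrib_left sum_divide_distrib)
      then show "(\<Sum>u\<in>G n. \<phi> (n, u) x) = bmp n x" using spos[OF x, of n] by simp
    qed simp
    also have "\<dots> = 1" using bmp_sum[of x] by simp
    finally show "(\<Sum>V | V \<in> I \<and> (if V \<in> I then \<phi> V x else 0) \<noteq> 0. if V \<in> I then \<phi> V x else 0) = 1"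
      using eq'[where x = x and c = "\<lambda>_. 1"] by simp
  next
    fix V x j assume V: "V \<in> I" "x \<in> K" "(if V \<in> I then \<phi> V x else 0) \<noteq> 0" "j \<in> J"
    obtain n u where nu: "V = (n, u)" "u \<in> G n" using V by (auto simp: I_def)
    have nz: "bmp n x \<noteq> 0" "u x \<noteq> 0" using V(1,3) by (auto simp: nu \<phi>_def)
    then have "\<bar>f j x\<bar> \<le> real n + 1" using f\<rho>[OF V(4), of x] bmp_nz[of n x] by linarith
    then have "\<bar>f j x - \<beta> n u j\<bar> \<le> e" using G\<beta>[OF nu(2) _ nz(2) V(4)] V(2) KX by blast
    then show "\<bar>f j x - (case V of (n, u) \<Rightarrow> \<beta> n u) j\<bar> \<le> e" by (simp add: nu)
  next
    fix c :: "nat \<times> ('a \<Rightarrow> real) \<Rightarrow> real"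
    have "continuous_map (subtopology X K) euclideanreal (\<lambda>x. \<Sum>V | V \<in> I \<and> \<phi> V x \<noteq> 0. c V * \<phi> V x)"
    proof (rule continuous_map_local_agreement[OF continuous_map_from_subtopology[OF \<rho>c]])
      fix b
      show "continuous_map (subtopology X K) euclideanreal (\<lambda>x. \<Sum>V\<in>Sigma {..b} G. c V * \<phi> V x)"
        using Gfin by (intro continuous_intros \<phi>c) auto
      fix x assume "x \<in> topspace (subtopology X K)" and \<rho>x: "\<rho> x < real b"
      then have x: "x \<in> K" using tK by auto
      have b: "n \<le> b" if "bmp n x \<noteq> 0" for n using that \<rho>x bmp_nz[of n x] by linarith
      show "(\<Sum>V | V \<in> I \<and> \<phi> V x \<noteq> 0. c V * \<phi> V x) = (\<Sum>V\<in>Sigma {..b} G. c V * \<phi> V x)"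
      proof (rule sum.mono_neutral_left)
        show "finite (Sigma {..b} G)" using Gfin by auto
        show "{V \<in> I. \<phi> V x \<noteq> 0} \<subseteq> Sigma {..b} G" using b by (auto simp: I_def \<phi>_def)
        show "\<forall>V\<in>Sigma {..b} G - {V \<in> I. \<phi> V x \<noteq> 0}. c V * \<phi> V x = 0"
          using x by (auto simp: I_def \<phi>_def)
      qed
    qed
    then show "continuous_map (subtopology X K) euclideanreal
        (\<lambda>x. \<Sum>V | V \<in> I \<and> (if V \<in> I then \<phi> V x else 0) \<noteq> 0. c V * (if V \<in> I then \<phi> V x else 0))"
      unfolding eq' .
  next
    assume "\<And>j. j \<in> J \<Longrightarrow> bounded (f j ` K)"
    then have "\<forall>j\<in>J. \<exists>B. \<forall>x\<in>K. \<bar>f j x\<bar> \<le> B" by (auto simp: bounded_iff)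
    then obtain B where B: "\<And>j x. j \<in> J \<Longrightarrow> x \<in> K \<Longrightarrow> \<bar>f j x\<bar> \<le> B j" by metis
    have "I \<subseteq> Sigma {..nat \<lceil>sum B J + 1\<rceil>} G"
    proof
      fix V assume "V \<in> I"
      then obtain n u x where V: "V = (n, u)" "u \<in> G n" "x \<in> K" "bmp n x \<noteq> 0" by (auto simp: I_def)
      have "\<rho> x \<le> sum B J" unfolding \<rho>_def using B V(3) by (intro sum_mono) auto
      then have "real n \<le> sum B J + 1" using V(4) bmp_nz[of n x] by linarith
      then have "n \<le> nat \<lceil>sum B J + 1\<rceil>" by linarith
      then show "V \<in> Sigma {..nat \<lceil>sum B J + 1\<rceil>} G" using V by auto
    qed
    then show "finite I" by (rule finite_subset) (use Gfin in auto)
  qed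
  then show ?thesis unfolding K_def N_def by blast
qed

section \<open>Dimension of the pieces\<close>

context pointwise_surjection
begin

text \<open>Tietze extension into an interval: the whole line when all continuous functions are
  allowed, a bounded interval otherwise. The absolute value of \<open>B\<close> keeps that interval
  nonempty even for empty \<open>K\<close>.\<close>

lemma extend_to_DX:
  assumes K: "closedin X K" and h: "continuous_map (subtopology X K) euclideanreal h"
    and bdd: "DX \<noteq> cont_funs X \<Longrightarrow> bounded (h ` K)"
  shows "\<exists>g. g \<in> DX \<and> (\<forall>x\<in>K. g x = h x)"
proof -
  have KX: "K \<subseteq> topspace X" using K by (rule closedin_subset)
  have "\<exists>R. is_interval R \<and> R \<noteq> {} \<and> h ` K \<subseteq> R \<and> (DX \<noteq> cont_funs X \<longrightarrow> bounded R)"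
  proof (cases "DX = cont_funs X")
    case False
    then obtain B where "\<And>x. x \<in> K \<Longrightarrow> \<bar>h x\<bar> \<le> B" using bdd by (auto simp: bounded_iff)
    then show ?thesis
      by (intro exI[of _ "{-\<bar>B\<bar>..\<bar>B\<bar>}"]) (force simp: is_interval_cc abs_le_iff)
  qed (intro exI[of _ UNIV], auto)
  then obtain R where R: "is_interval R" "R \<noteq> {}" "h ` K \<subseteq> R" "DX \<noteq> cont_funs X \<longrightarrow> bounded R"
    by blast
  obtain g where g: "continuous_map X euclideanreal g" "g ` topspace X \<subseteq> R" "\<forall>x\<in>K. g x = h x"
    using Tietze_extension_realinterval[OF normX K R(1,2) h R(3)] by metis
  have "restrict g (topspace X) \<in> DX"
    by (rule restrict_in_DX[OF g(1)]) (use R(4) g(2) bounded_subset in blast)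
  then show ?thesis using g(3) KX by (intro exI[of _ "restrict g (topspace X)"]) auto
qed

text \<open>Take \<open>t V\<close> to be the functional applied to \<open>\<phi> V\<close>. At most
  \<open>q\<close> support points each meet at most \<open>n\<close> members, which bounds
  \<open>A\<close>. Combinations of the \<open>\<phi> V\<close> are evaluated exactly;
  \<open>f j\<close> is within \<open>e\<close> of such a combination on \<open>K\<close>, and the
  norm bound \<open>p\<close> turns this into \<open>p * e\<close>. That \<open>t\<close> vanishes
  on \<open>I - A\<close> allows two points to be compared over a common index set.\<close>

lemma functional_on_partition:
  fixes \<phi> :: "'v \<Rightarrow> 'a \<Rightarrow> real" and \<beta> :: "'v \<Rightarrow> 'j \<Rightarrow> real"
  assumes rep: "represents y S \<mu>" and S: "S \<subseteq> K" "card S \<le> q" "(\<Sum>x\<in>S. \<bar>\<mu> x\<bar>) \<le> p"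
    and P: "fine_partition X K n J f e I \<phi> \<beta>"
    and f: "f ` J \<subseteq> DX" and e: "0 \<le> e"
  shows "\<exists>A t. finite A \<and> A \<subseteq> I \<and> card A \<le> q * n \<and> (\<forall>V\<in>I - A. t V = 0) \<and>
    (\<forall>h\<in>DX. \<forall>c. (\<forall>x\<in>K. h x = (\<Sum>V | V \<in> I \<and> \<phi> V x \<noteq> 0. c V * \<phi> V x)) \<longrightarrow>
       T h y = (\<Sum>V\<in>A. t V * c V)) \<and>
    (\<forall>j\<in>J. \<bar>T (f j) y - (\<Sum>V\<in>A. t V * \<beta> V j)\<bar> \<le> p * e)"
proof -
  note \<phi>0 = fine_partitionD(2)[OF P] and fin = fine_partitionD(3)[OF P] and card = fine_partitionD(4)[OF P]
    and one = fine_partitionD(5)[OF P] and fine = fine_partitionD(6)[OF P]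
  have Sfin: "finite S" and Tf: "\<And>f. f \<in> DX \<Longrightarrow> T f y = (\<Sum>x\<in>S. \<mu> x * f x)"
    using rep by (auto simp: represents_def)
  define A where "A = (\<Union>x\<in>S. {V \<in> I. \<phi> V x \<noteq> 0})"
  define t where "t V = (\<Sum>x\<in>S. \<mu> x * \<phi> V x)" for V
  have Afin: "finite A" unfolding A_def using Sfin fin S(1) by auto
  have Acard: "card A \<le> q * n"
  proof -
    have "card A \<le> (\<Sum>x\<in>S. card {V \<in> I. \<phi> V x \<noteq> 0})" unfolding A_def by (rule card_UN_le[OF Sfin])
    also have "\<dots> \<le> (\<Sum>x\<in>S. n)" using card S(1) by (intro sum_mono) auto
    also have "\<dots> \<le> q * n" using S(2) by simp
    finally show ?thesis .
  qed
  have sumA: "(\<Sum>V | V \<in> I \<and> \<phi> V x \<noteq> 0. c V * \<phi> V x) = (\<Sum>V\<in>A. c V * \<phi> V x)" if "x \<in> S" for x c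
    using that Afin by (intro sum.mono_neutral_left) (auto simp: A_def)
  have oneA: "(\<Sum>V\<in>A. \<phi> V x) = 1" if "x \<in> S" for x
    using sumA[OF that, of "\<lambda>_. 1"] one[of x] that S(1) by auto
  have sw: "(\<Sum>x\<in>S. \<mu> x * (\<Sum>V\<in>A. c V * \<phi> V x)) = (\<Sum>V\<in>A. t V * c V)" for c
    unfolding t_def sum_distrib_left sum_distrib_right
    by (subst sum.swap) (simp add: mult_ac)
  show ?thesis
  proof (rule exI[of _ A], rule exI[of _ t], intro conjI ballI allI impI Afin Acard)
    show "A \<subseteq> I" by (auto simp: A_def)
    show "t V = 0" if "V \<in> I - A" for V
      using that unfolding t_def A_def by (intro sum.neutral) auto
    show "T h y = (\<Sum>V\<in>A. t V * c V)"
      if h: "h \<in> DX" "\<forall>x\<in>K. h x = (\<Sum>V | V \<in> I \<and> \<phi> V x \<noteq> 0. c V * \<phi> V x)" for h c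
    proof -
      have "T h y = (\<Sum>x\<in>S. \<mu> x * (\<Sum>V\<in>A. c V * \<phi> V x))"
        unfolding Tf[OF h(1)]
      proof (rule sum.cong)
        fix x assume x: "x \<in> S"
        then have "h x = (\<Sum>V\<in>A. c V * \<phi> V x)" using h(2) S(1) sumA[OF x, of c] by auto
        then show "\<mu> x * h x = \<mu> x * (\<Sum>V\<in>A. c V * \<phi> V x)" by simp
      qed simp
      then show ?thesis using sw by simp
    qed
    fix j assume j: "j \<in> J"
    have "T (f j) y - (\<Sum>V\<in>A. t V * \<beta> V j) = (\<Sum>x\<in>S. \<mu> x * (f j x * 1)) - (\<Sum>x\<in>S. \<mu> x * (\<Sum>V\<in>A. \<beta> V j * \<phi> V x))"
      unfolding sw Tf[OF subsetD[OF f imageI[OF j]]] by simp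
    \<comment> \<open>Replacing 1 by the partition sum turns the error into a convex combination of
      the differences \<open>f j x - \<beta> V j\<close>.\<close>
    also have "\<dots> = (\<Sum>x\<in>S. \<mu> x * (f j x * (\<Sum>V\<in>A. \<phi> V x))) - (\<Sum>x\<in>S. \<mu> x * (\<Sum>V\<in>A. \<beta> V j * \<phi> V x))"
      using oneA by simp
    also have "\<dots> = (\<Sum>x\<in>S. \<mu> x * (\<Sum>V\<in>A. (f j x - \<beta> V j) * \<phi> V x))"
      by (simp add: sum_subtractf[symmetric] sum_distrib_left right_diff_distrib left_diff_distrib)
    finally have "\<bar>T (f j) y - (\<Sum>V\<in>A. t V * \<beta> V j)\<bar> \<le> (\<Sum>x\<in>S. \<bar>\<mu> x * (\<Sum>V\<in>A. (f j x - \<beta> V j) * \<phi> V x)\<bar>)"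
      by (simp only: sum_abs)
    also have "\<dots> \<le> (\<Sum>x\<in>S. \<bar>\<mu> x\<bar> * e)"
    proof (rule sum_mono)
      fix x assume x: "x \<in> S"
      have "\<bar>\<Sum>V\<in>A. (f j x - \<beta> V j) * \<phi> V x\<bar> \<le> (\<Sum>V\<in>A. \<bar>(f j x - \<beta> V j) * \<phi> V x\<bar>)" by (rule sum_abs)
      also have "\<dots> \<le> (\<Sum>V\<in>A. e * \<phi> V x)"
      proof (rule sum_mono)
        fix V assume V: "V \<in> A"
        have "\<bar>f j x - \<beta> V j\<bar> \<le> e \<or> \<phi> V x = 0" using fine[of V x j] V x j S(1) by (auto simp: A_def)
        then show "\<bar>(f j x - \<beta> V j) * \<phi> V x\<bar> \<le> e * \<phi> V x"
          using \<phi>0[OF subsetD[OF S(1) x], of V] by (auto simp: abs_mult intro: mult_right_mono)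
      qed
      also have "\<dots> = e" using oneA[OF x] by (simp flip: sum_distrib_left)
      finally show "\<bar>\<mu> x * (\<Sum>V\<in>A. (f j x - \<beta> V j) * \<phi> V x)\<bar> \<le> \<bar>\<mu> x\<bar> * e"
        by (simp add: abs_mult mult_left_mono)
    qed
    also have "\<dots> \<le> p * e" using S(3) e by (simp flip: sum_distrib_right add: mult_right_mono)
    finally show "\<bar>T (f j) y - (\<Sum>V\<in>A. t V * \<beta> V j)\<bar> \<le> p * e" .
  qed
qed

text \<open>Finitely many functions \<open>h m = (\<Sum>V. c V ^ m * \<phi> V)\<close> with sparse nodes \<open>c\<close>
  recover the coefficients of a functional along the partition of unity, up to errors that
  are negligible against the values \<open>\<beta> V j\<close>. Their number does not depend on \<open>f\<close>.\<close>

lemma controlling_functions: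
  fixes f :: "'j \<Rightarrow> 'a \<Rightarrow> real" and q p :: nat
  assumes H: "finite \<H>" "\<And>F. F \<in> \<H> \<Longrightarrow> closedin X F"
      "\<And>F. F \<in> \<H> \<Longrightarrow> covering_dim_le (subtopology X F) (d F)"
    and J: "finite J" "\<And>j. j \<in> J \<Longrightarrow> f j \<in> DX" and \<delta>: "0 < \<delta>"
  defines "R \<equiv> 4 * q * (\<Sum>F\<in>\<H>. Suc (d F))"
  shows "\<exists>h. (\<forall>m\<in>{1..Suc R}. h m \<in> DX) \<and>
    (\<forall>y\<in>piece (\<Union>\<H>) q p. \<forall>y'\<in>piece (\<Union>\<H>) q p. (\<forall>m\<in>{1..Suc R}. \<bar>T (h m) y - T (h m) y'\<bar> \<le> 1) \<longrightarrow>
       (\<forall>j\<in>J. \<bar>T (f j) y - T (f j) y'\<bar> \<le> \<delta>))"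
proof -
  define K where "K = \<Union>\<H>"
  have K: "closedin X K" unfolding K_def using H(1,2) by (rule closedin_Union)
  have KX: "K \<subseteq> topspace X" using K by (rule closedin_subset)
  define n where "n = 2 * (\<Sum>F\<in>\<H>. Suc (d F))"
  \<comment> \<open>Two points have at most \<open>q * n\<close> nonzero coefficients each, so their
    difference involves at most \<open>R\<close> nodes.\<close>
  have R: "R = 2 * (q * n)" by (simp add: R_def n_def)
  \<comment> \<open>The error budget: \<open>p * e\<close> for passing to coefficients at each of
    the two points, and \<open>e\<close> for the difference of the coefficients.\<close>
  define e where "e = \<delta> / (2 * real p + 1)"
  have e: "0 < e" using \<delta> by (simp add: e_def)
  have "(2 * real p + 1) * e = \<delta>" using add_nonneg_pos[of "2 * real p" 1] unfolding e_def by simp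
  then have e\<delta>: "2 * (real p * e) + e = \<delta>" by (simp add: algebra_simps)
  have "\<exists>(I :: (nat \<times> ('a \<Rightarrow> real)) set) \<phi> \<beta>. fine_partition X K n J f e I \<phi> \<beta>"
    unfolding K_def n_def by (rule fine_partition_of_unity[OF normX H J(1) DX_continuous[OF J(2)] e])
  then obtain I :: "(nat \<times> ('a \<Rightarrow> real)) set" and \<phi> \<beta> where P: "fine_partition X K n J f e I \<phi> \<beta>"
    by (elim exE) (rule that)
  note I = fine_partitionD(1)[OF P] and \<phi>0 = fine_partitionD(2)[OF P] and fin = fine_partitionD(3)[OF P]
    and one = fine_partitionD(5)[OF P] and cont = fine_partitionD(7)[OF P] and bdd = fine_partitionD(8)[OF P]
  \<comment> \<open>The power sum bound will give
    \<open>\<bar>t V - t' V\<bar> * c V \<le> 2 ^ R\<close>. With \<open>c V\<close> this large, the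
    contribution of \<open>V\<close> to the difference is at most \<open>e / (R + 1)\<close>,
    however large \<open>\<beta> V j\<close> is.\<close>
  obtain c :: "nat \<times> ('a \<Rightarrow> real) \<Rightarrow> real"
    where "\<forall>V\<in>I. 0 < c V \<and> 2 ^ R * real (Suc R) * (\<Sum>j\<in>J. \<bar>\<beta> V j\<bar>) / e \<le> c V"
      and "\<forall>v\<in>I. \<forall>w\<in>I. v \<noteq> w \<longrightarrow> 1 + c w \<le> 2 * \<bar>c v - c w\<bar>"
    using sparse_sequence[OF I, of "\<lambda>V. 2 ^ R * real (Suc R) * (\<Sum>j\<in>J. \<bar>\<beta> V j\<bar>) / e"]
    by (elim exE conjE) (rule that)
  then have c: "\<And>V. V \<in> I \<Longrightarrow> 0 < c V"
    "\<And>V. V \<in> I \<Longrightarrow> 2 ^ R * real (Suc R) * (\<Sum>j\<in>J. \<bar>\<beta> V j\<bar>) / e \<le> c V"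
    "\<And>v w. v \<in> I \<Longrightarrow> w \<in> I \<Longrightarrow> v \<noteq> w \<Longrightarrow> 1 + c w \<le> 2 * \<bar>c v - c w\<bar>"
    by blast+
  have "\<forall>m. \<exists>h. h \<in> DX \<and> (\<forall>x\<in>K. h x = (\<Sum>V | V \<in> I \<and> \<phi> V x \<noteq> 0. c V ^ m * \<phi> V x))"
  proof (rule allI, rule extend_to_DX[OF K cont])
    fix m :: nat
    \<comment> \<open>In the bounded case the \<open>f j\<close> are bounded, hence \<open>I\<close>
      is finite and the weighted sum is bounded by the sum of all weights.\<close>
    assume "DX \<noteq> cont_funs X"
    then have "bounded (f j ` K)" if "j \<in> J" for j
      by (rule bounded_subset[OF DX_bounded[OF J(2)[OF that]] image_mono[OF KX]])
    then have If: "finite I" by (rule bdd)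
    show "bounded ((\<lambda>x. \<Sum>V | V \<in> I \<and> \<phi> V x \<noteq> 0. c V ^ m * \<phi> V x) ` K)"
    proof (rule boundedI, clarsimp)
      fix x assume x: "x \<in> K"
      have le1: "\<phi> V x \<le> 1" if "V \<in> I" for V
      proof (cases "\<phi> V x = 0")
        case False
        then show ?thesis
          using member_le_sum[of V "{V \<in> I. \<phi> V x \<noteq> 0}" "\<lambda>V. \<phi> V x"] that fin[OF x] one[OF x] \<phi>0[OF x] by simp
      qed simp
      have "\<bar>\<Sum>V | V \<in> I \<and> \<phi> V x \<noteq> 0. c V ^ m * \<phi> V x\<bar> \<le> (\<Sum>V | V \<in> I \<and> \<phi> V x \<noteq> 0. \<bar>c V ^ m * \<phi> V x\<bar>)"
        by (rule sum_abs)
      also have "\<dots> \<le> (\<Sum>V\<in>I. \<bar>c V ^ m * \<phi> V x\<bar>)" using If by (intro sum_mono2) auto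
      also have "\<dots> \<le> (\<Sum>V\<in>I. \<bar>c V ^ m\<bar>)"
        using le1 \<phi>0[OF x] by (intro sum_mono) (auto simp: abs_mult intro!: mult_left_le)
      finally show "\<bar>\<Sum>V | V \<in> I \<and> \<phi> V x \<noteq> 0. c V ^ m * \<phi> V x\<bar> \<le> (\<Sum>V\<in>I. \<bar>c V ^ m\<bar>)" .
    qed
  qed
  from choice[OF this] obtain h where
    "\<forall>m. h m \<in> DX \<and> (\<forall>x\<in>K. h m x = (\<Sum>V | V \<in> I \<and> \<phi> V x \<noteq> 0. c V ^ m * \<phi> V x))" ..
  then have h: "h m \<in> DX"
    "x \<in> K \<Longrightarrow> h m x = (\<Sum>V | V \<in> I \<and> \<phi> V x \<noteq> 0. c V ^ m * \<phi> V x)" for m x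
    by simp_all
  have fJ: "f ` J \<subseteq> DX" using J(2) by blast
  have coeffs: "\<exists>A t. finite A \<and> A \<subseteq> I \<and> card A \<le> q * n \<and> (\<forall>V\<in>I - A. t V = 0) \<and>
    (\<forall>m. T (h m) y = (\<Sum>V\<in>A. t V * c V ^ m)) \<and>
    (\<forall>j\<in>J. \<bar>T (f j) y - (\<Sum>V\<in>A. t V * \<beta> V j)\<bar> \<le> real p * e)" if y: "y \<in> piece K q p" for y
  proof -
    obtain S \<mu> where "represents y S \<mu>" "S \<subseteq> K" "card S \<le> q" "(\<Sum>x\<in>S. \<bar>\<mu> x\<bar>) \<le> real p"
      by (rule piece_represents[OF K y])
    from functional_on_partition[OF this P fJ less_imp_le[OF e]]
    obtain A t where At: "finite A" "A \<subseteq> I" "card A \<le> q * n" "\<forall>V\<in>I - A. t V = 0"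
      and Th: "\<forall>h\<in>DX. \<forall>c. (\<forall>x\<in>K. h x = (\<Sum>V | V \<in> I \<and> \<phi> V x \<noteq> 0. c V * \<phi> V x)) \<longrightarrow>
        T h y = (\<Sum>V\<in>A. t V * c V)"
      and Tf: "\<forall>j\<in>J. \<bar>T (f j) y - (\<Sum>V\<in>A. t V * \<beta> V j)\<bar> \<le> real p * e"
      by (elim exE conjE) (rule that)
    have "T (h m) y = (\<Sum>V\<in>A. t V * c V ^ m)" for m
      using Th[rule_format, OF h(1), of m "\<lambda>V. c V ^ m"] h(2) by simp
    then show ?thesis by (intro exI[of _ A] exI[of _ t] conjI allI At Tf)
  qed
  have "\<bar>T (f j) y - T (f j) y'\<bar> \<le> \<delta>"
    if y: "y \<in> piece K q p" "y' \<in> piece K q p" and near: "\<forall>m\<in>{1..Suc R}. \<bar>T (h m) y - T (h m) y'\<bar> \<le> 1"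
      and j: "j \<in> J" for y y' j
  proof -
    obtain A t where A: "finite A" "A \<subseteq> I" "card A \<le> q * n" "\<forall>V\<in>I - A. t V = 0"
      "\<forall>m. T (h m) y = (\<Sum>V\<in>A. t V * c V ^ m)" "\<forall>j\<in>J. \<bar>T (f j) y - (\<Sum>V\<in>A. t V * \<beta> V j)\<bar> \<le> real p * e"
      using coeffs[OF y(1)] by (elim exE conjE) (rule that)
    obtain A' t' where A': "finite A'" "A' \<subseteq> I" "card A' \<le> q * n" "\<forall>V\<in>I - A'. t' V = 0"
      "\<forall>m. T (h m) y' = (\<Sum>V\<in>A'. t' V * c V ^ m)" "\<forall>j\<in>J. \<bar>T (f j) y' - (\<Sum>V\<in>A'. t' V * \<beta> V j)\<bar> \<le> real p * e"
      using coeffs[OF y(2)] by (elim exE conjE) (rule that)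
    define W where "W = A \<union> A'"
    have W: "finite W" "W \<subseteq> I" using A A' by (auto simp: W_def)
    have Wcard: "card W \<le> R" using card_Un_le[of A A'] A(3) A'(3) by (simp add: W_def R)
    have tW: "(\<Sum>V\<in>A. t V * b V) = (\<Sum>V\<in>W. t V * b V)" for b
      using A W by (intro sum.mono_neutral_left) (auto simp: W_def)
    have t'W: "(\<Sum>V\<in>A'. t' V * b V) = (\<Sum>V\<in>W. t' V * b V)" for b
      using A' W by (intro sum.mono_neutral_left) (auto simp: W_def)
    have dW: "(\<Sum>V\<in>A. t V * b V) - (\<Sum>V\<in>A'. t' V * b V) = (\<Sum>V\<in>W. (t V - t' V) * b V)" for b
      unfolding tW t'W by (simp add: sum_subtractf left_diff_distrib)
    \<comment> \<open>The power sums of the coefficient differences are the differences of the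
      values of \<open>T (h m)\<close>, which are at most 1 by nearness.\<close>
    have small: "\<bar>t V - t' V\<bar> * c V \<le> 2 ^ R * 1" if "V \<in> W" for V
    proof (rule sparse_power_sums_bound[OF W(1) that])
      show "card W \<le> Suc R" using Wcard by simp
      fix m assume "m \<in> {1..Suc R}"
      then have "\<bar>T (h m) y - T (h m) y'\<bar> \<le> 1" using near by blast
      then show "\<bar>\<Sum>V\<in>W. (t V - t' V) * c V ^ m\<bar> \<le> 1"
        unfolding A(5)[rule_format] A'(5)[rule_format] dW .
    qed (use c(1,3) subsetD[OF W(2)] in simp_all)
    have bound: "\<bar>(t V - t' V) * \<beta> V j\<bar> \<le> e / real (Suc R)" if V: "V \<in> W" for V
    proof -
      have "\<bar>\<beta> V j\<bar> \<le> (\<Sum>j\<in>J. \<bar>\<beta> V j\<bar>)" using J(1) j by (intro member_le_sum) auto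
      then have "2 ^ R * real (Suc R) * \<bar>\<beta> V j\<bar> \<le> 2 ^ R * real (Suc R) * (\<Sum>j\<in>J. \<bar>\<beta> V j\<bar>)"
        by (intro mult_left_mono) auto
      also have "\<dots> \<le> c V * e" using c(2)[of V] V W(2) e by (auto simp: pos_divide_le_eq)
      finally have "\<bar>t V - t' V\<bar> * (2 ^ R * real (Suc R) * \<bar>\<beta> V j\<bar>) \<le> \<bar>t V - t' V\<bar> * (c V * e)"
        by (rule mult_left_mono) simp
      also have "\<dots> \<le> 2 ^ R * e" using mult_right_mono[OF small[OF V], of e] e by simp
      finally have "2 ^ R * (\<bar>(t V - t' V) * \<beta> V j\<bar> * real (Suc R)) \<le> 2 ^ R * e"
        by (simp only: abs_mult mult_ac)
      then have "\<bar>(t V - t' V) * \<beta> V j\<bar> * real (Suc R) \<le> e"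
        by (rule mult_left_le_imp_le) simp
      then show ?thesis by (simp add: pos_le_divide_eq)
    qed
    have "\<bar>\<Sum>V\<in>W. (t V - t' V) * \<beta> V j\<bar> \<le> (\<Sum>V\<in>W. e / real (Suc R))"
      using bound by (intro order_trans[OF sum_abs] sum_mono)
    also have "\<dots> = real (card W) * (e / real (Suc R))" by simp
    also have "\<dots> \<le> real (Suc R) * (e / real (Suc R))"
      using Wcard e by (intro mult_right_mono) auto
    also have "\<dots> = e" by simp
    finally have "\<bar>(\<Sum>V\<in>A. t V * \<beta> V j) - (\<Sum>V\<in>A'. t' V * \<beta> V j)\<bar> \<le> e" unfolding dW .
    moreover have "\<bar>T (f j) y - (\<Sum>V\<in>A. t V * \<beta> V j)\<bar> \<le> real p * e"
      "\<bar>T (f j) y' - (\<Sum>V\<in>A'. t' V * \<beta> V j)\<bar> \<le> real p * e"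
      using A(6) A'(6) j by auto
    ultimately show ?thesis using e\<delta> by linarith
  qed
  then show ?thesis unfolding K_def using h(1) by (intro exI[of _ h]) blast
qed

text \<open>A cover of the piece is normalised to functions with sum 1, which surjectivity realises
  as \<open>T (f U)\<close>. The controlling functions map the piece to a space of
  \<open>R + 1\<close> coordinates in which points of a unit cube have nearly equal values
  \<open>T (f U)\<close>, so small cubes refine the cover. Since \<open>R\<close> is fixed before
  the cover, this bounds the dimension.\<close>

lemma piece_covering_dim:
  assumes H: "finite \<H>" "\<And>F. F \<in> \<H> \<Longrightarrow> closedin X F"
      "\<And>F. F \<in> \<H> \<Longrightarrow> covering_dim_le (subtopology X F) (d F)"
  shows "\<exists>n. covering_dim_le (subtopology Y (piece (\<Union>\<H>) q p)) n"
proof -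
  define R where "R = 4 * q * (\<Sum>F\<in>\<H>. Suc (d F))"
  define Z where "Z = piece (\<Union>\<H>) q p"
  have Z: "closedin Y Z" unfolding Z_def by (rule closedin_piece)
  have ZY: "Z \<subseteq> topspace Y" using Z by (rule closedin_subset)
  have tZ: "topspace (subtopology Y Z) = Z" using ZY by auto
  \<comment> \<open>The cubes give at most \<open>2 ^ Suc R\<close> members at a point; the
    definition would allow one more, so the stated dimension is not sharp.\<close>
  have "covering_dim_le (subtopology Y Z) (2 ^ Suc R)"
    unfolding covering_dim_le_def tZ
  proof (intro allI impI)
    fix \<U> assume \<U>: "finite_cozero_cover (subtopology Y Z) \<U>"
    then have \<U>fin: "finite \<U>" and \<U>Z: "\<Union>\<U> = Z" and "\<forall>U\<in>\<U>. cozero_in (subtopology Y Z) U"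
      unfolding finite_cozero_cover_def tZ by auto
    then obtain a where ac: "\<And>U. U \<in> \<U> \<Longrightarrow> continuous_map (subtopology Y Z) euclideanreal (a U)"
      and aU: "\<And>U. U \<in> \<U> \<Longrightarrow> U = {y \<in> Z. a U y \<noteq> 0}"
      unfolding cozero_in_def tZ by metis
    define s where "s y = (\<Sum>U\<in>\<U>. \<bar>a U y\<bar>)" for y
    have spos: "0 < s y" if y: "y \<in> Z" for y
    proof -
      obtain U where "U \<in> \<U>" "y \<in> U" using \<U>Z y by blast
      then show ?thesis unfolding s_def using aU[of U] \<U>fin by (intro sum_pos2[of _ U]) auto
    qed
    \<comment> \<open>The quotients take values in \<open>{0..1}\<close> and extend to
      \<open>Y\<close> with the same range, so the extensions are bounded and lie in
      \<open>DY\<close> for either choice.\<close>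
    have "\<exists>f\<in>DX. \<forall>y\<in>Z. T f y = \<bar>a U y\<bar> / s y" if U: "U \<in> \<U>" for U
    proof -
      have sc: "continuous_map (subtopology Y Z) euclideanreal s"
        unfolding s_def using ac \<U>fin by (intro continuous_intros) auto
      have sn: "s y \<noteq> 0" if "y \<in> topspace (subtopology Y Z)" for y using spos[of y] that tZ by auto
      have cont: "continuous_map (subtopology Y Z) euclideanreal (\<lambda>y. \<bar>a U y\<bar> / s y)"
        using ac[OF U] sc sn by (intro continuous_intros)
      have im: "(\<lambda>y. \<bar>a U y\<bar> / s y) ` Z \<subseteq> {0..1}"
      proof (clarsimp, intro conjI)
        fix y assume y: "y \<in> Z"
        show "0 \<le> \<bar>a U y\<bar> / s y" using spos[OF y] by simp
        have "\<bar>a U y\<bar> \<le> s y" unfolding s_def using \<U>fin U by (intro member_le_sum) auto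
        then show "\<bar>a U y\<bar> / s y \<le> 1" using spos[OF y] by simp
      qed
      obtain g where g: "continuous_map Y euclideanreal g" "\<forall>y\<in>Z. g y = \<bar>a U y\<bar> / s y" "g ` topspace Y \<subseteq> {0..1}"
        using Tietze_extension_closed_real_interval[OF normY Z cont im zero_le_one] by metis
      have "restrict g (topspace Y) \<in> DY"
        using g bounded_subset[OF bounded_closed_interval] by (intro restrict_in_DY) auto
      then obtain f where "f \<in> DX" "T f = restrict g (topspace Y)" using surjT by (metis imageE)
      then show ?thesis using g(2) ZY by (intro bexI[of _ f]) auto
    qed
    then obtain f where f: "\<And>U. U \<in> \<U> \<Longrightarrow> f U \<in> DX"
      "\<And>U y. U \<in> \<U> \<Longrightarrow> y \<in> Z \<Longrightarrow> T (f U) y = \<bar>a U y\<bar> / s y" by metis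
    \<comment> \<open>The values \<open>T (f U) y\<close> sum to 1, so they cannot all be at most
      \<open>\<delta>\<close>. Where one exceeds \<open>\<delta>\<close>, a change of at most
      \<open>\<delta>\<close> leaves it positive, so the nearby point stays in the same
      \<open>U\<close>.\<close>
    define \<delta> where "\<delta> = 1 / (real (card \<U>) + 1)"
    have \<delta>: "0 < \<delta>" by (simp add: \<delta>_def)
    have "\<exists>h. (\<forall>m\<in>{1..Suc R}. h m \<in> DX) \<and>
      (\<forall>y\<in>Z. \<forall>y'\<in>Z. (\<forall>m\<in>{1..Suc R}. \<bar>T (h m) y - T (h m) y'\<bar> \<le> 1) \<longrightarrow>
         (\<forall>U\<in>\<U>. \<bar>T (f U) y - T (f U) y'\<bar> \<le> \<delta>))"
      unfolding Z_def R_def by (rule controlling_functions[OF H \<U>fin f(1) \<delta>])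
    then obtain h where h: "\<forall>m\<in>{1..Suc R}. h m \<in> DX"
      "\<forall>y\<in>Z. \<forall>y'\<in>Z. (\<forall>m\<in>{1..Suc R}. \<bar>T (h m) y - T (h m) y'\<bar> \<le> 1) \<longrightarrow>
         (\<forall>U\<in>\<U>. \<bar>T (f U) y - T (f U) y'\<bar> \<le> \<delta>)"
      by (elim exE conjE) (rule that)
    have "\<exists>\<V>. finite_cozero_cover (subtopology Y Z) \<V> \<and> (\<forall>V\<in>\<V>. \<exists>U\<in>\<U>. V \<subseteq> U) \<and>
        (\<forall>y\<in>topspace (subtopology Y Z). card {V \<in> \<V>. y \<in> V} \<le> 2 ^ card {1..Suc R})"
    proof (rule cubical_refinement[OF _ _ \<U>fin])
      show "finite {1..Suc R}" by simp
      show "continuous_map (subtopology Y Z) euclideanreal (T (h m))" if "m \<in> {1..Suc R}" for m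
        using that h(1) by (intro continuous_map_from_subtopology T_continuous) auto
      fix y assume "y \<in> topspace (subtopology Y Z)"
      then have y: "y \<in> Z" using tZ by simp
      have "\<exists>U\<in>\<U>. \<delta> < T (f U) y"
      proof (rule ccontr)
        assume "\<not> ?thesis"
        then have "(\<Sum>U\<in>\<U>. T (f U) y) \<le> (\<Sum>U\<in>\<U>. \<delta>)" by (intro sum_mono) (auto simp: not_less)
        also have "\<dots> < 1" by (simp add: \<delta>_def)
        also have "(\<Sum>U\<in>\<U>. T (f U) y) = s y / s y"
          using f(2) y by (simp add: s_def flip: sum_divide_distrib)
        finally show False using spos[OF y] by simp
      qed
      then obtain U where U: "U \<in> \<U>" "\<delta> < T (f U) y" by blast
      show "\<exists>U\<in>\<U>. \<forall>y'\<in>topspace (subtopology Y Z).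
          (\<forall>m\<in>{1..Suc R}. \<bar>T (h m) y - T (h m) y'\<bar> \<le> 1) \<longrightarrow> y' \<in> U"
      proof (intro bexI[of _ U] ballI impI U)
        fix y' assume "y' \<in> topspace (subtopology Y Z)" and near: "\<forall>m\<in>{1..Suc R}. \<bar>T (h m) y - T (h m) y'\<bar> \<le> 1"
        then have y': "y' \<in> Z" using tZ by simp
        have "\<bar>T (f U) y - T (f U) y'\<bar> \<le> \<delta>" using h(2) y y' near U(1) by blast
        then have "0 < T (f U) y'" using U(2) by linarith
        then have "a U y' \<noteq> 0" using f(2)[OF U(1) y'] by auto
        then show "y' \<in> U" using aU[OF U(1)] y' by blast
      qed
    qed
    then obtain \<V> where \<V>: "finite_cozero_cover (subtopology Y Z) \<V>" "\<forall>V\<in>\<V>. \<exists>U\<in>\<U>. V \<subseteq> U"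
      "\<forall>y\<in>Z. card {V \<in> \<V>. y \<in> V} \<le> 2 ^ Suc R" unfolding tZ by (auto simp del: power_Suc)
    then show "\<exists>\<V>. finite_cozero_cover (subtopology Y Z) \<V> \<and> (\<forall>V\<in>\<V>. \<exists>U\<in>\<U>. V \<subseteq> U) \<and>
        (\<forall>x\<in>Z. card {V \<in> \<V>. x \<in> V} \<le> 2 ^ Suc R + 1)"
      by (intro exI[of _ \<V>]) (simp add: le_SucI)
  qed
  then show ?thesis unfolding Z_def by blast
qed

section \<open>Countably many pieces exhaust the range space\<close>

lemma strongly_countable_dimensional_range:
  assumes "strongly_countable_dimensional X"
  shows "strongly_countable_dimensional Y"
proof -
  obtain \<F> where \<F>: "countable \<F>" "\<Union>\<F> = topspace X"
    and "\<forall>F\<in>\<F>. closedin X F \<and> (\<exists>n. covering_dim_le (subtopology X F) n)"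
    using assms unfolding strongly_countable_dimensional_def by blast
  then obtain d where F: "\<And>F. F \<in> \<F> \<Longrightarrow> closedin X F"
    "\<And>F. F \<in> \<F> \<Longrightarrow> covering_dim_le (subtopology X F) (d F)" by metis
  \<comment> \<open>Finite subfamilies of a countable family are countably many. They suffice
    because the support of each functional is finite, although no common bound on supports, norms or
    dimensions exists in general.\<close>
  define \<P> where "\<P> = (\<lambda>(\<H>, q, p). piece (\<Union>\<H>) q p) ` ({\<H>. finite \<H> \<and> \<H> \<subseteq> \<F>} \<times> UNIV \<times> UNIV)"
  show ?thesis
    unfolding strongly_countable_dimensional_def
  proof (intro exI[of _ \<P>] conjI ballI)
    show "countable \<P>"
      unfolding \<P>_def using countable_Collect_finite_subset[OF \<F>(1)] by (intro countable_image countable_SIGMA) auto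
    have "y \<in> \<Union>\<P>" if y: "y \<in> topspace Y" for y
    proof -
      obtain S \<mu> where rep: "represents y S \<mu>" using ex_represents[OF y] by blast
      then have S: "finite S" "S \<subseteq> \<Union>\<F>" using \<F>(2) by (auto simp: represents_def)
      then obtain \<H> where "finite \<H>" "\<H> \<subseteq> \<F>" "S \<subseteq> \<Union>\<H>" using finite_subset_Union by metis
      \<comment> \<open>The parameters are the size of the support and the norm rounded up to a
        natural number.\<close>
      moreover from this have "y \<in> piece (\<Union>\<H>) (card S) (nat \<lceil>\<Sum>x\<in>S. \<bar>\<mu> x\<bar>\<rceil>)"
        by (intro represents_imp_piece[OF y rep]) auto
      ultimately show ?thesis unfolding \<P>_def by blast
    qed
    then show "\<Union>\<P> = topspace Y" using piece_subset unfolding \<P>_def by blast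
    fix P assume "P \<in> \<P>"
    then obtain \<H> q p where P: "P = piece (\<Union>\<H>) q p" and H: "finite \<H>" "\<H> \<subseteq> \<F>" unfolding \<P>_def by auto
    show "closedin Y P" unfolding P by (rule closedin_piece)
    show "\<exists>n. covering_dim_le (subtopology Y P) n"
      unfolding P using H F by (intro piece_covering_dim[of _ d]) auto
  qed
qed

end

theorem corollary1p2:
  fixes X :: "'a topology" and Y :: "'b topology"
    and DX :: "('a \<Rightarrow> real) set" and DY :: "('b \<Rightarrow> real) set"
    and T :: "('a \<Rightarrow> real) \<Rightarrow> 'b \<Rightarrow> real"
  assumes "normal_space X" and "Hausdorff_space X"
    and "normal_space Y" and "Hausdorff_space Y"
    and "DX = cont_funs X \<or> DX = bdd_cont_funs X"
    and "DY = cont_funs Y \<or> DY = bdd_cont_funs Y"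
    and "linear_operator_on X Y DX T"
    and "continuous_map (pointwise_topology X DX) (pointwise_topology Y DY) T"
    and "T ` DX = DY"
    and "strongly_countable_dimensional X"
  shows "strongly_countable_dimensional Y"
proof -
  interpret pointwise_surjection X Y DX DY T
    by (unfold_locales; fact)
  show ?thesis using assms(10) by (rule strongly_countable_dimensional_range)
qed

end
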